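(* Assume that: $g$ is bounded; $f$ is convex and differentiable with $\nabla f$ Lipschitz continuous with constant $L$; for every $\lambda\in\mathcal{H}_f:=\nabla f(\mathcal{H})$, $g_\lambda$ is lower semi-continuous on $Z$, $G_\lambda$ is a lower semi-continuous set-valued map and $\mathrm{BR}_\lambda(x)\ne\emptyset$ for all $x\in X$. Assume moreover that: $X$ is a closed subset of a separable Banach space; $g\colon Z\to\mathcal{H}$ is continuous; $Z_x$ is compact for every $x\in X$ and $F$ is upper semi-continuous; and there is $L_g\ge0$ such that $\mathcal{Z}\colon X\rightsquigarrow\mathcal{H}$, $\mathcal{Z}(x)=\{g(x,y):y\in Z_x\}$, is $L_g$-Lipschitz. Let $m\in\mathcal{P}^1(X)$, let $N\ge1$, $x_1,\dots,x_N\in X$ and $m_N=\frac1N\sum_{i=1}^N\delta_{x_i}$. Let $1\le K\le 2N$, let $y^K$ be the output after $K$ iterations of the Stochastic Frank-Wolfe algorithm with arbitrary numbers $n_k\ge1$ of simulations, let $\mu_N^K=\frac1N\sum_{i=1}^N\delta_{(x_i,y_i^K)}$, and let $\tilde\mu^K\in\mathcal{P}_m(Z)$ be the output of the bridging method with inputs $m_0=m_N$, $m_1=m$, $\bar\mu_0=\mu_N^K$. Then $$\mathbb{E}\left[f\left(\int_Z g\,d\tilde\mu^K\right)\right]-\inf_{\mu\in\mathcal{P}_m(Z)}f\left(\int_Z g\,d\mu\right)\le\frac{4LD}{K}+2L_g(C+LM)\,d_1(m_N,m).$$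
   Context: $X$ and $Y$ are complete separable metric spaces with metrics $d_X,d_Y$ and Borel $\sigma$-algebras; $\mathcal{P}(\cdot)$ denotes the set of Borel probability measures. $F\colon X\rightsquigarrow Y$ is a set-valued map with non-empty values and closed graph; $Z_x:=F(x)$, $Z:=\{(x,y): y\in Z_x\}\subseteq X\times Y$. $\mathcal{H}$ is a separable real Hilbert space; $g\colon Z\to\mathcal{H}$, $f\colon\mathcal{H}\to\mathbb{R}$ are Borel measurable. With $\pi_1(x,y)=x$, $\mathcal{P}_m(Z)=\{\mu\in\mathcal{P}(Z):\pi_1\#\mu=m\}$. Integrals of $g$ are Bochner integrals. For $\lambda\in\mathcal{H}$: $g_\lambda(x,y)=\langle\lambda,g(x,y)\rangle$, $G_\lambda(x)=\{g_\lambda(x,y):y\in Z_x\}\subseteq\mathbb{R}$, $\mathrm{BR}_\lambda(x)=\operatorname{argmin}_{y\in Z_x}g_\lambda(x,y)$. Constants: $M=\sup_{z\in Z}\|g(z)\|$, $D=\sup_{z_1,z_2\in Z}\|g(z_1)-g(z_2)\|^2$, $C=\sup_{\mu\in\mathcal{P}(Z)}\|\nabla f(\int_Z g\,d\mu)\|$. Set-valued maps $\Phi$ (non-empty values): lower semi-continuous if for every $x$, $y\in\Phi(x)$ and $x_n\to x$ there are $y_n\in\Phi(x_n)$ with $y_n\to y$; upper semi-continuous if for every $x$ and every neighborhood $\mathcal{U}$ of $\Phi(x)$ there is $\eta>0$ with $\Phi(x')\subseteq\mathcal{U}$ whenever $d_X(x,x')\le\eta$; $\mathcal{Z}$ is $L_g$-Lipschitz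 if $\mathcal{Z}(x_1)\subseteq\mathcal{Z}(x_2)+B_{\mathcal{H}}(0,L_g d_X(x_1,x_2))$ for all $x_1,x_2\in X$ (closed ball). $\mathcal{P}^1(X)$ is the set of $m\in\mathcal{P}(X)$ with $\int d_X(x,x_0)\,dm(x)<\infty$ for some $x_0\in X$; $d_1(m_0,m_1)=\sup\{\int_X h\,d(m_0-m_1): h\colon X\to\mathbb{R}\text{ 1-Lipschitz}\}$. Stochastic Frank-Wolfe algorithm: start from $y^0\in\prod_{i=1}^N Z_{x_i}$. For $k=0,1,\dots,K-1$: set $\lambda^k=\nabla f(\frac1N\sum_{i=1}^N g(x_i,y_i^k))$; for each $i$ choose $\bar y_i^k\in\mathrm{BR}_{\lambda^k}(x_i)$; set $\omega_k=2/(k+2)$; for $j=1,\dots,n_k$ and $i=1,\dots,N$ simulate $P_i^{k,j}\sim\mathrm{Bern}(\omega_k)$ independently of all previously defined random variables, and let $\hat y_i^{k,j}=\bar y_i^k$ if $P_i^{k,j}=1$ and $\hat y_i^{k,j}=y_i^k$ if $P_i^{k,j}=0$; put $\hat y^{k,j}=(\hat y_i^{k,j})_{i}$; choose $y^{k+1}$ minimizing $y\mapsto f(\frac1N\sum_{i=1}^N g(x_i,y_i))$ over $\{\hat y^{k,j}:j=1,\dots,n_k\}$. Bridging method, with inputs $m_0,m_1\in\mathcal{P}^1(X)$, $\bar\mu_0\in\mathcal{P}_{m_0}(Z)$: (Step 1) take a solution $\rho$ of $\inf_{\rho\in\Pi(m_0,m_1)}\int_{X\times X}d_X(x,x')\,d\rho(x,x')$,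 where $\Pi(m_0,m_1)$ is the set of probability measures on $X\times X$ with marginals $m_0,m_1$; (Step 2) take $\nu\in\mathcal{P}(Z\times X)$ with $\pi_{12}\#\nu=\bar\mu_0$ and $\pi_{13}\#\nu=\rho$, where $\pi_{12}(x,y,x')=(x,y)$, $\pi_{13}(x,y,x')=(x,x')$; (Step 3) output $s\#\nu$, where $s\colon Z\times X\to Z$ is a Borel measurable selection of $S(x,y,x')=\{(x',y')\in Z:\|g(x',y')-g(x,y)\|\le L_g d_X(x,x')\}$. All choices in the two algorithms (of $\bar y_i^k$, $y^{k+1}$, $\rho$, $\nu$, $s$) are made by arbitrary fixed rules from the data available at that stage, so that only finitely many outcomes are possible and the expectation makes sense. *)

theory Defs
  imports "HOL-Probability.Probability"
begin

section \<open>Semicontinuity and set-valued maps\<close>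

definition lsc_fun_on :: "'a::topological_space set \<Rightarrow> ('a \<Rightarrow> real) \<Rightarrow> bool" where
  "lsc_fun_on S \<phi> \<longleftrightarrow>
     (\<forall>z\<in>S. \<forall>a. a < \<phi> z \<longrightarrow> (\<forall>\<^sub>F w in at z within S. a < \<phi> w))"

definition lsc_setmap_on ::
    "'a::metric_space set \<Rightarrow> ('a \<Rightarrow> 'b::topological_space set) \<Rightarrow> bool" where
  "lsc_setmap_on X \<Phi> \<longleftrightarrow>
     (\<forall>x\<in>X. \<forall>y\<in>\<Phi> x. \<forall>\<xi>::nat \<Rightarrow> 'a. (\<forall>n. \<xi> n \<in> X) \<and> \<xi> \<longlonglongrightarrow> x \<longrightarrow>
        (\<exists>\<upsilon>. (\<forall>n. \<upsilon> n \<in> \<Phi> (\<xi> n)) \<and> \<upsilon> \<longlonglongrightarrow> y))"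

text \<open>A neighborhood \<open>U\<close> of the set \<open>\<Phi> x\<close> is a set whose interior contains \<open>\<Phi> x\<close>.\<close>

definition usc_setmap_on ::
    "'a::metric_space set \<Rightarrow> ('a \<Rightarrow> 'b::topological_space set) \<Rightarrow> bool" where
  "usc_setmap_on X \<Phi> \<longleftrightarrow>
     (\<forall>x\<in>X. \<forall>U. \<Phi> x \<subseteq> interior U \<longrightarrow>
        (\<exists>\<eta>>0. \<forall>x'\<in>X. dist x x' \<le> \<eta> \<longrightarrow> \<Phi> x' \<subseteq> U))"

definition lipschitz_setmap_on ::
    "real \<Rightarrow> 'a::metric_space set \<Rightarrow> ('a \<Rightarrow> 'h::real_normed_vector set) \<Rightarrow> bool" where
  "lipschitz_setmap_on L X \<Phi> \<longleftrightarrow>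
     (\<forall>x1\<in>X. \<forall>x2\<in>X. \<Phi> x1 \<subseteq> \<Phi> x2 + cball 0 (L * dist x1 x2))"


section \<open>Gradient and best response\<close>

definition gradient :: "('h::real_inner \<Rightarrow> real) \<Rightarrow> 'h \<Rightarrow> 'h" where
  "gradient f x = (THE D. GDERIV f x :> D)"

definition scal :: "('a \<times> 'b \<Rightarrow> 'h::real_inner) \<Rightarrow> 'h \<Rightarrow> 'a \<times> 'b \<Rightarrow> real" where
  "scal g l z = l \<bullet> g z"

definition BR :: "('a \<Rightarrow> 'b set) \<Rightarrow> ('a \<times> 'b \<Rightarrow> 'h::real_inner) \<Rightarrow> 'h \<Rightarrow> 'a \<Rightarrow> 'b set" where
  "BR F g l x = {y. is_arg_min (\<lambda>y. scal g l (x, y)) (\<lambda>y. y \<in> F x) y}"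


section \<open>Probability measures on a subset of a topological space\<close>

abbreviation borel_of_set :: "'a::topological_space set \<Rightarrow> 'a measure" where
  "borel_of_set S \<equiv> restrict_space borel S"

definition prob_on :: "'a::topological_space set \<Rightarrow> 'a measure set" where
  "prob_on S = {\<mu>. prob_space \<mu> \<and> sets \<mu> = sets (borel_of_set S)}"

definition prob1_on :: "'a::metric_space set \<Rightarrow> 'a measure set" where
  "prob1_on X = {m \<in> prob_on X. \<exists>x0\<in>X. integrable m (\<lambda>x. dist x x0)}"

text \<open>Probability measures on \<open>Z \<subseteq> X \<times> Y\<close> whose first marginal is \<open>m\<close>.\<close>

definition prob_with_marginal ::
    "'a::topological_space set \<Rightarrow> ('a \<times> 'b::topological_space) set \<Rightarrow> 'a measure
      \<Rightarrow> ('a \<times> 'b) measure set" where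
  "prob_with_marginal X Z m = {\<mu> \<in> prob_on Z. distr \<mu> (borel_of_set X) fst = m}"

text \<open>The measure \<open>(1/N) \<Sum>\<^sub>i \<delta>(p i)\<close>, \<open>i = 1, \<dots>, N\<close>, on \<open>S\<close>.\<close>

definition empirical :: "'a::topological_space set \<Rightarrow> nat \<Rightarrow> (nat \<Rightarrow> 'a) \<Rightarrow> 'a measure" where
  "empirical S N p = measure_of S (sets (borel_of_set S))
     (\<lambda>A. (\<Sum>i=1..N. emeasure (return (borel_of_set S) (p i)) A) / of_nat N)"

text \<open>The supremum below is that of a bounded set of reals whenever both measures have a finite
  first moment.\<close>

definition d1 :: "'a::metric_space set \<Rightarrow> 'a measure \<Rightarrow> 'a measure \<Rightarrow> real" where
  "d1 X m0 m1 =
     (SUP h\<in>{h :: 'a \<Rightarrow> real. 1-lipschitz_on X h}. (\<integral>x. h x \<partial>m0) - (\<integral>x. h x \<partial>m1))"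


section \<open>The constants\<close>

definition const_M :: "('a \<times> 'b) set \<Rightarrow> ('a \<times> 'b \<Rightarrow> 'h::real_normed_vector) \<Rightarrow> real" where
  "const_M Z g = (SUP z\<in>Z. norm (g z))"

definition const_D :: "('a \<times> 'b) set \<Rightarrow> ('a \<times> 'b \<Rightarrow> 'h::real_normed_vector) \<Rightarrow> real" where
  "const_D Z g = (SUP (z1, z2)\<in>Z \<times> Z. (norm (g z1 - g z2))\<^sup>2)"

definition const_C ::
    "('a::topological_space \<times> 'b::topological_space) set
      \<Rightarrow> ('a \<times> 'b \<Rightarrow> 'h::{real_inner, banach, second_countable_topology})
      \<Rightarrow> ('h \<Rightarrow> real) \<Rightarrow> real" where
  "const_C Z g f = (SUP \<mu>\<in>prob_on Z. norm (gradient f (\<integral>z. g z \<partial>\<mu>)))"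


section \<open>Stochastic Frank-Wolfe algorithm\<close>

text \<open>Agents and simulations are numbered from 1. The draws of round \<open>k\<close> are a family
  \<open>P (j, i)\<close>, \<open>j \<in> {1..n k}\<close>, \<open>i \<in> {1..N}\<close>, of independent Bernoulli variables
  (the value \<open>False\<close> outside the index set is a dummy). A history of length \<open>k\<close> is the list of
  the draws of rounds \<open>0, \<dots>, k - 1\<close>.\<close>

type_synonym draws = "nat \<times> nat \<Rightarrow> bool"
type_synonym history = "draws list"

definition sfw_round :: "(nat \<Rightarrow> nat) \<Rightarrow> nat \<Rightarrow> nat \<Rightarrow> draws pmf" where
  "sfw_round n N k =
     Pi_pmf ({1..n k} \<times> {1..N}) False (\<lambda>_. bernoulli_pmf (2 / (real k + 2)))"

primrec sfw_draws :: "(nat \<Rightarrow> nat) \<Rightarrow> nat \<Rightarrow> nat \<Rightarrow> history pmf" where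
  "sfw_draws n N 0 = return_pmf []"
| "sfw_draws n N (Suc k) =
     bind_pmf (sfw_draws n N k) (\<lambda>h. map_pmf (\<lambda>P. h @ [P]) (sfw_round n N k))"

definition agg ::
    "('a \<times> 'b \<Rightarrow> 'h::real_vector) \<Rightarrow> nat \<Rightarrow> (nat \<Rightarrow> 'a) \<Rightarrow> (nat \<Rightarrow> 'b) \<Rightarrow> 'h" where
  "agg g N x v = (1 / real N) *\<^sub>R (\<Sum>i=1..N. g (x i, v i))"

definition candidate :: "(nat \<Rightarrow> 'b) \<Rightarrow> (nat \<Rightarrow> 'b) \<Rightarrow> draws \<Rightarrow> nat \<Rightarrow> nat \<Rightarrow> 'b" where
  "candidate ybar y P j = (\<lambda>i. if P (j, i) then ybar i else y i)"

text \<open>The initial point and the rules being fixed, all data available at some stage of the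
  algorithm are functions of the draws made so far. The choices are therefore given by functions
  of the history: after the history \<open>h\<close> of length \<open>k\<close>, \<open>y h\<close> is the iterate \<open>y\<^sup>k\<close>,
  \<open>ybar h\<close> is the family of best responses chosen in round \<open>k\<close> (before the draws \<open>P\<close> of that
  round), and \<open>y (h @ [P])\<close> is \<open>y\<^sup>k\<^sup>+\<^sup>1\<close>. Only histories of positive probability are
  constrained.\<close>

definition sfw_run ::
    "('a \<Rightarrow> 'b set) \<Rightarrow> ('a \<times> 'b \<Rightarrow> 'h::real_inner) \<Rightarrow> ('h \<Rightarrow> real)
      \<Rightarrow> nat \<Rightarrow> (nat \<Rightarrow> 'a) \<Rightarrow> (nat \<Rightarrow> nat) \<Rightarrow> nat
      \<Rightarrow> (history \<Rightarrow> nat \<Rightarrow> 'b) \<Rightarrow> (history \<Rightarrow> nat \<Rightarrow> 'b) \<Rightarrow> bool" where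
  "sfw_run F g f N x n K ybar y \<longleftrightarrow>
     (\<forall>i\<in>{1..N}. y [] i \<in> F (x i)) \<and>
     (\<forall>k<K. \<forall>h\<in>set_pmf (sfw_draws n N k).
        (\<forall>i\<in>{1..N}. ybar h i \<in> BR F g (gradient f (agg g N x (y h))) (x i)) \<and>
        (\<forall>P\<in>set_pmf (sfw_round n N k).
           is_arg_min (\<lambda>v. f (agg g N x v))
             (\<lambda>v. v \<in> {candidate (ybar h) (y h) P j | j. j \<in> {1..n k}})
             (y (h @ [P]))))"


section \<open>Bridging method\<close>

definition couplings ::
    "'a::topological_space set \<Rightarrow> 'a measure \<Rightarrow> 'a measure \<Rightarrow> ('a \<times> 'a) measure set" where
  "couplings X m0 m1 =
     {\<rho> \<in> prob_on (X \<times> X). distr \<rho> (borel_of_set X) fst = m0 \<and> distr \<rho> (borel_of_set X) snd = m1}"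

text \<open>\<open>dist\<close> is integrable under every coupling of two measures with finite first moments, so
  the Bochner integral is the transport cost.\<close>

definition optimal_plan ::
    "'a::metric_space set \<Rightarrow> 'a measure \<Rightarrow> 'a measure \<Rightarrow> ('a \<times> 'a) measure \<Rightarrow> bool" where
  "optimal_plan X m0 m1 \<rho> \<longleftrightarrow>
     is_arg_min (\<lambda>\<rho>. \<integral>(x, x'). dist x x' \<partial>\<rho>) (\<lambda>\<rho>. \<rho> \<in> couplings X m0 m1) \<rho>"

definition bridge_set ::
    "('a::metric_space \<times> 'b) set \<Rightarrow> ('a \<times> 'b \<Rightarrow> 'h::real_normed_vector) \<Rightarrow> real
      \<Rightarrow> ('a \<times> 'b) \<times> 'a \<Rightarrow> ('a \<times> 'b) set" where
  "bridge_set Z g Lg = (\<lambda>((x, y), x').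
     {(x'', y'). x'' = x' \<and> (x', y') \<in> Z \<and> norm (g (x', y') - g (x, y)) \<le> Lg * dist x x'})"

text \<open>\<open>\<mu>\<close> is a possible output for the inputs \<open>m0\<close>, \<open>m1\<close>, \<open>\<mu>0\<close>. The product \<open>Z \<times> X\<close> is
  read as a set of pairs \<open>((x, y), x')\<close>.\<close>

definition bridging_output ::
    "'a::metric_space set \<Rightarrow> ('a \<times> 'b::topological_space) set
      \<Rightarrow> ('a \<times> 'b \<Rightarrow> 'h::real_normed_vector) \<Rightarrow> real
      \<Rightarrow> 'a measure \<Rightarrow> 'a measure \<Rightarrow> ('a \<times> 'b) measure \<Rightarrow> ('a \<times> 'b) measure \<Rightarrow> bool" where
  "bridging_output X Z g Lg m0 m1 \<mu>0 \<mu> \<longleftrightarrow>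
     (\<exists>\<rho> \<nu> s.
        optimal_plan X m0 m1 \<rho> \<and>
        \<nu> \<in> prob_on (Z \<times> X) \<and>
        distr \<nu> (borel_of_set Z) fst = \<mu>0 \<and>
        distr \<nu> (borel_of_set (X \<times> X)) (\<lambda>((x, y), x'). (x, x')) = \<rho> \<and>
        s \<in> borel_of_set (Z \<times> X) \<rightarrow>\<^sub>M borel_of_set Z \<and>
        (\<forall>w\<in>Z \<times> X. s w \<in> bridge_set Z g Lg w) \<and>
        \<mu> = distr \<nu> (borel_of_set Z) s)"

end

theory Submission
  imports Defs
begin

text \<open>Write \<open>u\<^sub>k\<close> for the aggregate of the \<open>k\<close>-th iterate and let \<open>\<mu>\<close> have first marginal \<open>m\<close>. For
  \<open>\<lambda> = \<nabla>f u\<^sub>k\<close> the value function \<open>t \<mapsto> min {\<langle>\<lambda>, g (t, y)\<rangle> | y \<in> F t}\<close> is \<open>norm \<lambda> * Lg\<close>-Lipschitz, so the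
  Frank-Wolfe model at \<open>u\<^sub>k\<close>, minimized over the sampled agents, is at most
  \<open>f (\<integral> g d\<mu>) + C * Lg * d1\<close>. The usual Frank-Wolfe recursion, with a variance term of order \<open>1 / N\<close>
  from the independent draws, then gives the rate relative to this shifted target.

  The bridging step moves the integral of \<open>g\<close> by at most \<open>Lg\<close> times the optimal transport cost, and
  convexity turns this into a second error \<open>C * Lg * d1\<close> once the cost is bounded by \<open>d1\<close>. This
  hard half of the Kantorovich-Rubinstein theorem is only needed when one marginal is finitely
  supported. There the dual is a finite-dimensional concave problem; smoothing its maximum by
  log-sum-exp makes the softmax weights at a maximizer a coupling that is optimal up to an
  arbitrarily small error.\<close>

section \<open>Gradients in Hilbert space\<close>

text \<open>The expression is nonnegative and vanishes at \<open>t = 0\<close>, so 0 is a minimum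
  and the derivative \<open>c\<close> there must be zero. It is the first-order optimality condition
  for the quadratic functional in the Riesz argument.\<close>

lemma quadratic_perturbation_zero:
  fixes c q :: real
  assumes "\<And>t. 0 \<le> t * c + t\<^sup>2 * q"
  shows "c = 0"
proof -
  have "((\<lambda>t. t * c + t\<^sup>2 * q) has_real_derivative c) (at 0)"
    by (auto intro!: derivative_eq_intros)
  moreover have "\<forall>t. \<bar>0 - t\<bar> < 1 \<longrightarrow> (\<lambda>t. t * c + t\<^sup>2 * q) 0 \<le> (\<lambda>t. t * c + t\<^sup>2 * q) t"
    using assms by simp
  ultimately show ?thesis
    using DERIV_local_min[of "\<lambda>t. t * c + t\<^sup>2 * q" c 0 1] by simp
qed

text \<open>The representer is the minimizer of \<open>(norm v)\<^sup>2 / 2 - \<phi> v\<close>; minimizing sequences are Cauchy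
  by the parallelogram law.\<close>

lemma riesz_representation:
  fixes \<phi> :: "'h::{real_inner, banach} \<Rightarrow> real"
  assumes "bounded_linear \<phi>"
  obtains v where "\<And>h. \<phi> h = h \<bullet> v"
proof -
  interpret bounded_linear \<phi> by fact
  define q where "q v = (norm v)\<^sup>2 / 2 - \<phi> v" for v
  obtain B where B: "\<And>v. norm (\<phi> v) \<le> norm v * B" using bounded by blast
  have "q v \<ge> - (B\<^sup>2 / 2)" for v
  proof -
    have "\<phi> v \<le> norm v * B" using B[of v] by simp
    moreover have "0 \<le> (norm v - B)\<^sup>2" by simp
    ultimately show ?thesis unfolding q_def power2_diff by simp
  qed
  then have bdd: "bdd_below (range q)" by (intro bdd_belowI[of _ "- (B\<^sup>2 / 2)"]) auto
  define I where "I = Inf (range q)"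
  have I_le: "I \<le> q v" for v unfolding I_def using bdd by (auto intro: cInf_lower)
  have "\<exists>v. q v < I + 1 / real (Suc j)" for j
    using cInf_lessD[of "range q" "I + 1 / real (Suc j)"] unfolding I_def by auto
  then obtain w where w: "\<And>j. q (w j) < I + 1 / real (Suc j)" by metis
  \<comment> \<open>The parallelogram law expressed through \<open>q\<close>: the linear part
    \<open>\<phi>\<close> cancels against its value at the midpoint. Hence two points with nearly
    minimal \<open>q\<close> are close to each other.\<close>
  have par: "(norm (a - b))\<^sup>2 = 4 * (q a + q b - 2 * q ((1/2) *\<^sub>R (a + b)))" for a b
    unfolding q_def power2_norm_eq_inner scaleR add inner_simps
    by (simp add: inner_commute[of b a] field_simps)
  have gap: "(norm (w i - w j))\<^sup>2 \<le> 4 * (1 / real (Suc i) + 1 / real (Suc j))" for i j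
    using w[of i] w[of j] I_le[of "(1/2) *\<^sub>R (w i + w j)"] unfolding par by simp
  have "Cauchy w"
  proof (rule CauchyI)
    fix e :: real assume e: "0 < e"
    then obtain J where J: "1 / real (Suc J) < e\<^sup>2 / 8"
      using reals_Archimedean[of "e\<^sup>2 / 8"] by (auto simp: inverse_eq_divide)
    have "norm (w i - w j) < e" if "J \<le> i" "J \<le> j" for i j
    proof -
      have "1 / real (Suc i) \<le> 1 / real (Suc J)" "1 / real (Suc j) \<le> 1 / real (Suc J)"
        using that by (auto intro!: divide_left_mono)
      then have "(norm (w i - w j))\<^sup>2 < e\<^sup>2" using gap[of i j] J by simp
      then show ?thesis using e power2_less_imp_less by fastforce
    qed
    then show "\<exists>M. \<forall>i\<ge>M. \<forall>j\<ge>M. norm (w i - w j) < e" by blast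
  qed
  then obtain v where v: "w \<longlonglongrightarrow> v" using Cauchy_convergent convergent_def by blast
  have "(\<lambda>j. q (w j)) \<longlonglongrightarrow> q v" unfolding q_def
    by (intro tendsto_intros v tendsto) simp
  moreover have "(\<lambda>j. I + 1 / real (Suc j)) \<longlonglongrightarrow> I + 0"
    by (intro tendsto_intros LIMSEQ_Suc[OF lim_1_over_n])
  ultimately have qv: "q v \<le> I"
    using LIMSEQ_le[of "\<lambda>j. q (w j)" "q v" "\<lambda>j. I + 1 / real (Suc j)" I] w less_imp_le by auto
  have "\<phi> h = h \<bullet> v" for h
  proof -
    have "0 \<le> t * (h \<bullet> v - \<phi> h) + t\<^sup>2 * ((norm h)\<^sup>2 / 2)" for t
    proof -
      have "q (v + t *\<^sub>R h) - q v = t * (h \<bullet> v - \<phi> h) + t\<^sup>2 * ((norm h)\<^sup>2 / 2)"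
        unfolding q_def power2_norm_eq_inner scaleR add inner_simps
        by (simp add: inner_commute[of v h] field_simps power2_eq_square)
      then show ?thesis using qv I_le[of "v + t *\<^sub>R h"] by simp
    qed
    then show ?thesis using quadratic_perturbation_zero by fastforce
  qed
  then show ?thesis using that by blast
qed

text \<open>\<open>gradient\<close> is a definite description, so both existence and uniqueness have
  to be supplied. Existence is Riesz representation of the derivative; uniqueness holds because
  derivatives are unique and inner products separate points.\<close>

lemma GDERIV_gradient:
  fixes f :: "'h::{real_inner, banach} \<Rightarrow> real"
  assumes "f differentiable (at u)"
  shows "GDERIV f u :> gradient f u"
proof -
  obtain f' where f': "(f has_derivative f') (at u)"
    using assms unfolding differentiable_def by blast
  then obtain D where "\<And>h. f' h = h \<bullet> D"
    using riesz_representation has_derivative_bounded_linear by blast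
  then have "f' = (\<lambda>h. h \<bullet> D)" by auto
  then have D: "GDERIV f u :> D" using f' unfolding gderiv_def by simp
  have "D' = D" if "GDERIV f u :> D'" for D'
  proof -
    have "(\<lambda>h. h \<bullet> D') = (\<lambda>h. h \<bullet> D)"
      using that D has_derivative_unique unfolding gderiv_def by blast
    then show ?thesis by (simp add: fun_eq_iff vector_eq_ldot)
  qed
  then show ?thesis unfolding gradient_def using theI[of "gderiv f u", OF D] by blast
qed

lemma has_real_derivative_along_line:
  fixes f :: "'h::{real_inner, banach} \<Rightarrow> real"
  assumes "\<And>u. f differentiable (at u)"
  shows "((\<lambda>t. f (u + t *\<^sub>R w)) has_real_derivative (gradient f (u + t *\<^sub>R w) \<bullet> w)) (at t)"
proof -
  have 1: "((\<lambda>t. u + t *\<^sub>R w) has_derivative (\<lambda>s. s *\<^sub>R w)) (at t)"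
    by (auto intro!: derivative_eq_intros)
  have "((\<lambda>t. f (u + t *\<^sub>R w)) has_derivative (\<lambda>s. (s *\<^sub>R w) \<bullet> gradient f (u + t *\<^sub>R w))) (at t)"
    using has_derivative_compose[OF 1 GDERIV_gradient[OF assms, unfolded gderiv_def]] .
  then show ?thesis
    by (rule has_derivative_imp_has_field_derivative) (simp add: inner_commute)
qed

text \<open>By convexity the difference quotients along the segment from \<open>u\<close> to
  \<open>v\<close> are at most \<open>f v - f u\<close> for \<open>t\<close> in (0, 1). Letting
  \<open>t\<close> tend to 0 from the right turns them into the directional derivative.\<close>

lemma convex_gradient_inequality:
  fixes f :: "'h::{real_inner, banach} \<Rightarrow> real"
  assumes diff: "\<And>u. f differentiable (at u)" and "convex_on UNIV f"
  shows "f u + gradient f u \<bullet> (v - u) \<le> f v"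
proof -
  have "((\<lambda>t. (f (u + t *\<^sub>R (v - u)) - f u) / t) \<longlongrightarrow> gradient f u \<bullet> (v - u)) (at 0)"
    using has_real_derivative_along_line[OF diff, of u "v - u" 0]
    by (simp add: has_field_derivative_iff)
  then have lim: "((\<lambda>t. (f (u + t *\<^sub>R (v - u)) - f u) / t) \<longlongrightarrow> gradient f u \<bullet> (v - u)) (at_right 0)"
    by (rule filterlim_mono) (auto simp: at_le)
  have "\<forall>\<^sub>F t in at_right 0. (f (u + t *\<^sub>R (v - u)) - f u) / t \<le> f v - f u"
    unfolding eventually_at_right_field
  proof (intro exI[of _ 1] conjI allI impI)
    fix t :: real assume t: "0 < t" "t < 1"
    have "u + t *\<^sub>R (v - u) = (1 - t) *\<^sub>R u + t *\<^sub>R v" by (simp add: algebra_simps)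
    then have "f (u + t *\<^sub>R (v - u)) \<le> (1 - t) * f u + t * f v"
      using convex_onD[OF assms(2), of t u v] t by simp
    then show "(f (u + t *\<^sub>R (v - u)) - f u) / t \<le> f v - f u"
      using t by (simp add: field_simps)
  qed simp
  then have "gradient f u \<bullet> (v - u) \<le> f v - f u"
    using tendsto_upperbound[OF lim] by simp
  then show ?thesis by simp
qed

text \<open>The descent lemma. \<open>\<psi>\<close> is \<open>f\<close> along the segment minus its
  quadratic model; Cauchy-Schwarz and the Lipschitz bound make its derivative nonpositive for
  \<open>t \<ge> 0\<close>, so comparing \<open>\<psi> 1\<close> with \<open>\<psi> 0\<close>
  replaces integrating the gradient.\<close>

lemma lipschitz_gradient_upper_bound:
  fixes f :: "'h::{real_inner, banach} \<Rightarrow> real"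
  assumes diff: "\<And>u. f differentiable (at u)" and lip: "L-lipschitz_on UNIV (gradient f)"
  shows "f v \<le> f u + gradient f u \<bullet> (v - u) + L / 2 * (norm (v - u))\<^sup>2"
proof -
  define w where "w = v - u"
  define \<psi> where "\<psi> t = f (u + t *\<^sub>R w) - t * (gradient f u \<bullet> w) - L / 2 * t\<^sup>2 * (norm w)\<^sup>2" for t
  have der: "(\<psi> has_real_derivative
      gradient f (u + t *\<^sub>R w) \<bullet> w - gradient f u \<bullet> w - L * t * (norm w)\<^sup>2) (at t)" for t
    unfolding \<psi>_def
    by (rule derivative_eq_intros has_real_derivative_along_line[OF diff] refl | simp)+
  have "gradient f (u + t *\<^sub>R w) \<bullet> w - gradient f u \<bullet> w - L * t * (norm w)\<^sup>2 \<le> 0" if "0 \<le> t" for t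
  proof -
    have "(gradient f (u + t *\<^sub>R w) - gradient f u) \<bullet> w
        \<le> norm (gradient f (u + t *\<^sub>R w) - gradient f u) * norm w" by (rule norm_cauchy_schwarz)
    also have "\<dots> \<le> (L * (t * norm w)) * norm w"
      using lipschitz_onD[OF lip, of "u + t *\<^sub>R w" u] that
      by (intro mult_right_mono) (auto simp: dist_norm)
    finally show ?thesis by (simp add: inner_diff_left power2_eq_square mult.assoc)
  qed
  then have "\<psi> 1 \<le> \<psi> 0"
    using der by (intro DERIV_nonpos_imp_nonincreasing[of 0 1 \<psi>]) (simp, metis)
  then show ?thesis by (simp add: \<psi>_def w_def)
qed

section \<open>Empirical measures and the distance \<open>d1\<close>\<close>

lemma space_borel_of_set [simp]: "space (borel_of_set S) = S"
  by (simp add: space_restrict_space)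

lemma measurable_uniform_count_measure:
  "p ` A \<subseteq> space M \<Longrightarrow> p \<in> uniform_count_measure A \<rightarrow>\<^sub>M M"
  by (auto simp: measurable_def uniform_count_measure_def space_point_measure sets_point_measure)

text \<open>A \<open>measure_of\<close> can be evaluated only once its set function is known to be a
  measure. Recognizing it as the image of the uniform law on indices settles this and turns
  integrals into finite averages; repeated points cause no difficulty because \<open>p\<close> may
  fail to be injective.\<close>

lemma empirical_eq_distr:
  assumes p: "p ` {1..N} \<subseteq> S" and N: "1 \<le> N"
  shows "empirical S N p = distr (uniform_count_measure {1..N}) (borel_of_set S) p"
proof -
  let ?D = "distr (uniform_count_measure {1..N}) (borel_of_set S) p"
  have meas: "p \<in> uniform_count_measure {1..N} \<rightarrow>\<^sub>M borel_of_set S"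
    using p by (intro measurable_uniform_count_measure) simp
  have em: "(\<Sum>i=1..N. emeasure (return (borel_of_set S) (p i)) A) / of_nat N = emeasure ?D A"
    if A: "A \<in> sets (borel_of_set S)" for A
  proof -
    have "(\<Sum>i=1..N. emeasure (return (borel_of_set S) (p i)) A) = (\<Sum>i=1..N. indicator A (p i))"
      using A by simp
    also have "\<dots> = of_nat (card {i\<in>{1..N}. p i \<in> A})"
      by (simp add: indicator_def sum.If_cases Int_def)
    moreover have "emeasure ?D A = emeasure (uniform_count_measure {1..N}) {i\<in>{1..N}. p i \<in> A}"
      using A meas
      by (subst emeasure_distr) (auto simp: space_uniform_count_measure intro!: arg_cong2[of _ _ _ _ emeasure])
    moreover have "\<dots> = ennreal (card {i\<in>{1..N}. p i \<in> A} / N)"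
      by (subst emeasure_uniform_count_measure) auto
    ultimately show ?thesis
      using N by (simp add: ennreal_of_nat_eq_real_of_nat divide_ennreal)
  qed
  have "empirical S N p = measure_of S (sets (borel_of_set S)) (emeasure ?D)"
    unfolding empirical_def
  proof (rule measure_of_eq)
    show "sets (borel_of_set S) \<subseteq> Pow S" using sets.space_closed[of "borel_of_set S"] by simp
    fix A assume "A \<in> sigma_sets S (sets (borel_of_set S))"
    then have "A \<in> sets (borel_of_set S)" using sets.sigma_sets_eq[of "borel_of_set S"] by simp
    then show "(\<Sum>i=1..N. emeasure (return (borel_of_set S) (p i)) A) / of_nat N = emeasure ?D A"
      by (rule em)
  qed
  also have "\<dots> = ?D" using measure_of_of_measure[of ?D] by simp
  finally show ?thesis .
qed

lemma integral_empirical: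
  fixes \<phi> :: "'a::topological_space \<Rightarrow> 'h::{banach, second_countable_topology}"
  assumes p: "p ` {1..N} \<subseteq> S" and N: "1 \<le> N"
    and \<phi>: "\<phi> \<in> borel_measurable (borel_of_set S)"
  shows "(\<integral>z. \<phi> z \<partial>empirical S N p) = (1 / real N) *\<^sub>R (\<Sum>i=1..N. \<phi> (p i))"
proof -
  have "p \<in> uniform_count_measure {1..N} \<rightarrow>\<^sub>M borel_of_set S"
    by (rule measurable_uniform_count_measure) (simp only: space_borel_of_set p)
  then have "(\<integral>z. \<phi> z \<partial>empirical S N p) = (\<integral>i. \<phi> (p i) \<partial>uniform_count_measure {1..N})"
    unfolding empirical_eq_distr[OF p N] using \<phi> by (rule integral_distr)
  also have "\<dots> = (\<Sum>i=1..N. (1 / real (card {1..N})) *\<^sub>R \<phi> (p i))"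
    unfolding uniform_count_measure_def by (rule lebesgue_integral_point_measure_finite) auto
  finally show ?thesis by (simp add: scaleR_sum_right)
qed

lemma integrable_empirical:
  fixes \<phi> :: "'a::topological_space \<Rightarrow> 'h::{banach, second_countable_topology}"
  assumes p: "p ` {1..N} \<subseteq> S" and N: "1 \<le> N"
    and \<phi>: "\<phi> \<in> borel_measurable (borel_of_set S)"
  shows "integrable (empirical S N p) \<phi>"
proof -
  have meas: "p \<in> uniform_count_measure {1..N} \<rightarrow>\<^sub>M borel_of_set S"
    by (rule measurable_uniform_count_measure) (simp only: space_borel_of_set p)
  have "integrable (uniform_count_measure {1..N}) (\<lambda>i. \<phi> (p i))"
    unfolding uniform_count_measure_def by (rule integrable_point_measure_finite) auto
  then show ?thesis
    unfolding empirical_eq_distr[OF p N] integrable_distr_eq[OF meas \<phi>] .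
qed

lemma empirical_in_prob_on:
  assumes p: "p ` {1..N} \<subseteq> S" and N: "1 \<le> N"
  shows "empirical S N p \<in> prob_on S"
proof -
  have "prob_space (uniform_count_measure {1..N})"
    using N by (intro prob_space_uniform_count_measure) auto
  then show ?thesis
    unfolding prob_on_def empirical_eq_distr[OF p N]
    using p prob_space.prob_space_distr[OF _ measurable_uniform_count_measure, of "{1..N}" p "borel_of_set S"]
    by (simp del: One_nat_def)
qed

section \<open>Measurability and first moments for probability measures on a subset\<close>

lemma measurable_prob_on:
  "\<mu> \<in> prob_on S \<Longrightarrow> measurable \<mu> K = measurable (borel_of_set S) K"
  by (rule measurable_cong_sets) (simp_all add: prob_on_def)

lemma borel_measurable_prob_on:
  "\<mu> \<in> prob_on S \<Longrightarrow> continuous_on S \<phi> \<Longrightarrow> \<phi> \<in> borel_measurable \<mu>"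
  by (simp only: measurable_prob_on borel_measurable_continuous_on_restrict)

lemma space_prob_on: "\<mu> \<in> prob_on S \<Longrightarrow> space \<mu> = S"
  using sets_eq_imp_space_eq[of \<mu> "borel_of_set S"] by (simp add: prob_on_def)

lemma empirical_in_prob1_on:
  assumes p: "p ` {1..N} \<subseteq> X" and N: "1 \<le> N"
  shows "empirical X N p \<in> prob1_on X"
proof -
  have "p 1 \<in> X" using p N by auto
  moreover have "integrable (empirical X N p) (\<lambda>z. dist z (p 1))"
    by (intro integrable_empirical[OF p N] borel_measurable_continuous_on_restrict continuous_intros)
  ultimately show ?thesis using empirical_in_prob_on[OF p N] unfolding prob1_on_def by blast
qed

text \<open>The triangle inequality frees the first-moment condition from the particular base point
  in \<open>prob1_on\<close>, since constants are integrable for a probability measure.\<close>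

lemma integrable_dist:
  assumes m: "m \<in> prob1_on X" and x: "x \<in> X"
  shows "integrable m (\<lambda>t. dist x t)"
proof -
  obtain x0 where x0: "integrable m (\<lambda>t. dist t x0)" using m by (auto simp: prob1_on_def)
  have m': "m \<in> prob_on X" and "prob_space m" using m by (auto simp: prob1_on_def prob_on_def)
  interpret prob_space m by fact
  have "integrable m (\<lambda>t. dist x x0 + dist t x0)" using x0 by simp
  then show ?thesis
    by (rule Bochner_Integration.integrable_bound)
      (auto intro!: borel_measurable_prob_on[OF m'] continuous_intros dist_triangle2 AE_I2)
qed

lemma integrable_lipschitz:
  fixes h :: "'a::metric_space \<Rightarrow> real"
  assumes m: "m \<in> prob1_on X" and h: "C-lipschitz_on X h"
  shows "integrable m h"
proof -
  obtain x0 where x0: "x0 \<in> X" using m by (auto simp: prob1_on_def)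
  have m': "m \<in> prob_on X" and "prob_space m" using m by (auto simp: prob1_on_def prob_on_def)
  interpret prob_space m by fact
  have "integrable m (\<lambda>t. \<bar>h x0\<bar> + C * dist x0 t)" using integrable_dist[OF m x0] by simp
  then show ?thesis
  proof (rule Bochner_Integration.integrable_bound)
    show "h \<in> borel_measurable m"
      using borel_measurable_prob_on[OF m'] lipschitz_on_continuous_on[OF h] by blast
    show "AE t in m. norm (h t) \<le> norm (\<bar>h x0\<bar> + C * dist x0 t)"
    proof (rule AE_I2)
      fix t assume "t \<in> space m"
      then have "dist (h x0) (h t) \<le> C * dist x0 t"
        using lipschitz_onD[OF h x0] space_prob_on[OF m'] by simp
      then show "norm (h t) \<le> norm (\<bar>h x0\<bar> + C * dist x0 t)" by (simp add: dist_real_def)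
    qed
  qed
qed

text \<open>A supremum of reals dominates its members only if the set is bounded above. Subtracting
  the constant \<open>h x0\<close> does not affect the difference of integrals, and
  \<open>\<bar>h x - h x0\<bar> \<le> dist x0 x\<close> gives a bound by the two first moments,
  uniform in \<open>h\<close>.\<close>

lemma d1_ge:
  fixes m0 m1 :: "'a::metric_space measure"
  assumes m0: "m0 \<in> prob1_on X" and m1: "m1 \<in> prob1_on X" and h: "1-lipschitz_on X h"
  shows "(\<integral>x. h x \<partial>m0) - (\<integral>x. h x \<partial>m1) \<le> d1 X m0 m1"
  unfolding d1_def
proof (rule cSUP_upper)
  show "h \<in> {h. 1-lipschitz_on X h}" using h by simp
  obtain x0 where x0: "x0 \<in> X" using m0 by (auto simp: prob1_on_def)
  have bound: "(\<integral>x. h x \<partial>m0) - (\<integral>x. h x \<partial>m1) \<le> (\<integral>x. dist x0 x \<partial>m0) + (\<integral>x. dist x0 x \<partial>m1)"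
    if h: "1-lipschitz_on X h" for h
  proof -
    have 1: "\<bar>(\<integral>x. h x \<partial>m) - h x0\<bar> \<le> (\<integral>x. dist x0 x \<partial>m)" if m: "m \<in> prob1_on X" for m
    proof -
      have m': "m \<in> prob_on X" and "prob_space m" using m by (auto simp: prob1_on_def prob_on_def)
      interpret prob_space m by fact
      note int = integrable_lipschitz[OF m h] integrable_dist[OF m x0]
      have le: "\<bar>h x - h x0\<bar> \<le> dist x0 x" if "x \<in> space m" for x
        using lipschitz_onD[OF h x0, of x] that space_prob_on[OF m'] by (simp add: dist_real_def)
      have "(\<integral>x. h x \<partial>m) - h x0 = (\<integral>x. h x - h x0 \<partial>m)"
        using int by (simp add: prob_space)
      also have "\<bar>\<dots>\<bar> \<le> (\<integral>x. \<bar>h x - h x0\<bar> \<partial>m)" by (rule integral_abs_bound)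
      also have "\<dots> \<le> (\<integral>x. dist x0 x \<partial>m)"
        using int le by (intro integral_mono) auto
      finally show ?thesis .
    qed
    show ?thesis using 1[OF m0] 1[OF m1] by linarith
  qed
  show "bdd_above ((\<lambda>h. (\<integral>x. h x \<partial>m0) - (\<integral>x. h x \<partial>m1)) ` {h :: 'a \<Rightarrow> real. 1-lipschitz_on X h})"
    by (rule bdd_aboveI2, rule bound) simp
qed

text \<open>For positive \<open>C\<close> the function \<open>h x / C\<close> is an admissible test
  function. For \<open>C = 0\<close> the division is meaningless, but then \<open>h\<close> is
  constant on \<open>X\<close> and both integrals agree.\<close>

lemma d1_ge_scaled:
  fixes m0 m1 :: "'a::metric_space measure"
  assumes m0: "m0 \<in> prob1_on X" and m1: "m1 \<in> prob1_on X" and h: "C-lipschitz_on X h"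
  shows "(\<integral>x. h x \<partial>m0) - (\<integral>x. h x \<partial>m1) \<le> C * d1 X m0 m1"
proof (cases "C = 0")
  case True
  obtain x0 where x0: "x0 \<in> X" using m0 by (auto simp: prob1_on_def)
  have "(\<integral>x. h x \<partial>m) = h x0" if m: "m \<in> prob1_on X" for m
  proof -
    have m': "m \<in> prob_on X" and "prob_space m" using m by (auto simp: prob1_on_def prob_on_def)
    interpret prob_space m by fact
    have "(\<integral>x. h x \<partial>m) = (\<integral>x. h x0 \<partial>m)"
      using lipschitz_onD[OF h _ x0] True space_prob_on[OF m']
      by (intro Bochner_Integration.integral_cong) auto
    then show ?thesis by (simp add: prob_space)
  qed
  then show ?thesis using True m0 m1 by simp
next
  case False
  then have C: "0 < C" using lipschitz_on_nonneg[OF h] by simp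
  have "1-lipschitz_on X (\<lambda>x. h x / C)"
    using lipschitz_onD[OF h] C by (intro lipschitz_onI) (auto simp: dist_real_def field_simps
        simp flip: diff_divide_distrib)
  from d1_ge[OF m0 m1 this] show ?thesis using C by (simp add: field_simps)
qed

lemma d1_nonneg:
  fixes m0 m1 :: "'a::metric_space measure"
  assumes "m0 \<in> prob1_on X" "m1 \<in> prob1_on X"
  shows "0 \<le> d1 X m0 m1"
proof -
  have "1-lipschitz_on X (\<lambda>_. 0 :: real)" by (simp add: lipschitz_on_def)
  from d1_ge[OF assms this] show ?thesis by simp
qed

section \<open>Semi-discrete optimal transport\<close>

text \<open>The smooth maximum: for finite nonempty \<open>I\<close> it exceeds the maximum of
  \<open>b\<close> by at most \<open>ln (card I)\<close>, and its partial derivatives are the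
  softmax weights \<open>exp (b i - lse I b)\<close>.\<close>

definition lse :: "'i set \<Rightarrow> ('i \<Rightarrow> real) \<Rightarrow> real" where
  "lse I b = ln (\<Sum>i\<in>I. exp (b i))"

context
  fixes I :: "'i set"
  assumes I: "finite I" "I \<noteq> {}"
begin

lemma sum_exp_pos: "0 < (\<Sum>i\<in>I. exp (b i :: real))"
  using I by (intro sum_pos) auto

lemma exp_lse: "exp (lse I b) = (\<Sum>i\<in>I. exp (b i))"
  by (simp add: lse_def sum_exp_pos)

lemma lse_ge: "i \<in> I \<Longrightarrow> b i \<le> lse I b"
  using member_le_sum[of i I "\<lambda>i. exp (b i)"] I by (simp flip: exp_lse)

text \<open>Monotonicity and translation equivariance in one inequality. It yields the continuity of
  the dual, its shift invariance, and later the Lipschitz property of the dual potential.\<close>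

lemma lse_le_shift:
  assumes "\<And>i. i \<in> I \<Longrightarrow> b i \<le> b' i + s"
  shows "lse I b \<le> lse I b' + s"
proof -
  have "exp (lse I b) \<le> (\<Sum>i\<in>I. exp (b' i) * exp s)"
    unfolding exp_lse using assms by (intro sum_mono) (simp flip: exp_add)
  also have "\<dots> = exp (lse I b' + s)" by (simp add: exp_add exp_lse sum_distrib_right)
  finally show ?thesis by simp
qed

lemma lse_diff_le: "lse I b \<le> lse I b' + (\<Sum>i\<in>I. \<bar>b i - b' i\<bar>)"
proof (rule lse_le_shift)
  fix i assume "i \<in> I"
  then have "\<bar>b i - b' i\<bar> \<le> (\<Sum>i\<in>I. \<bar>b i - b' i\<bar>)"
    using I by (intro member_le_sum[of i I "\<lambda>i. \<bar>b i - b' i\<bar>"]) auto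
  then show "b i \<le> b' i + (\<Sum>i\<in>I. \<bar>b i - b' i\<bar>)" by linarith
qed

lemma abs_lse_le: "\<bar>lse I b\<bar> \<le> ln (card I) + (\<Sum>i\<in>I. \<bar>b i\<bar>)"
proof -
  have "lse I (\<lambda>_. 0) = ln (card I)" by (simp add: lse_def)
  moreover have "0 \<le> ln (card I)" using I by (simp add: Suc_leI card_gt_0_iff)
  ultimately show ?thesis using lse_diff_le[of b "\<lambda>_. 0"] lse_diff_le[of "\<lambda>_. 0" b] by simp
qed

lemma lse_shift: "lse I (\<lambda>i. b i + s) = lse I b + s"
  using lse_le_shift[of "\<lambda>i. b i + s" b s] lse_le_shift[of b "\<lambda>i. b i + s" "- s"] by simp

lemma sum_softmax: "(\<Sum>i\<in>I. exp (b i - lse I b)) = 1"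
  by (simp add: exp_diff exp_lse sum_exp_pos less_imp_neq[symmetric] flip: sum_divide_distrib)

text \<open>The effect of moving one coordinate is computed exactly and then linearized by
  \<open>ln (1 + z) \<le> z\<close>. At \<open>s = 0\<close> the bound is an equality with the
  softmax weight as slope, so optimality conditions can be read off without differentiating under an
  integral.\<close>

lemma lse_update_le:
  assumes j: "j \<in> I"
  shows "lse I (b(j := b j + s)) \<le> lse I b + (exp s - 1) * exp (b j - lse I b)"
proof -
  define q where "q = exp (b j - lse I b)"
  have "(\<Sum>i\<in>I. exp ((b(j := b j + s)) i)) = exp (b j + s) + (\<Sum>i\<in>I - {j}. exp (b i))"
    using I j by (subst sum.remove[of _ j]) auto
  also have "\<dots> = exp (lse I b) + exp (b j) * (exp s - 1)"
    using I j unfolding exp_lse by (subst sum.remove[of I j "\<lambda>i. exp (b i)"])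
      (auto simp: exp_add algebra_simps)
  also have "\<dots> = exp (lse I b) * (1 + (exp s - 1) * q)"
    by (simp add: q_def exp_diff field_simps)
  finally have S: "(\<Sum>i\<in>I. exp ((b(j := b j + s)) i)) = exp (lse I b) * (1 + (exp s - 1) * q)" .
  have pos: "0 < 1 + (exp s - 1) * q"
    using sum_exp_pos[of "b(j := b j + s)"] unfolding S by (simp add: zero_less_mult_iff)
  have "lse I (b(j := b j + s)) = lse I b + ln (1 + (exp s - 1) * q)"
    unfolding lse_def[of I "b(j := b j + s)"] S using pos by (simp add: ln_mult)
  also have "\<dots> \<le> lse I b + (exp s - 1) * q"
    using ln_add_one_self_le_self2[of "(exp s - 1) * q"] pos by simp
  finally show ?thesis by (simp add: q_def)
qed

text \<open>The gap is the entropy of the softmax weights. With \<open>z = lse I b - b i\<close>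
  each summand is \<open>exp (- z) * z \<le> 1\<close>, so the gap is at most \<open>card I\<close>;
  this error is later multiplied by an arbitrarily small factor.\<close>

lemma lse_le_softmax_average:
  "lse I b \<le> (\<Sum>i\<in>I. exp (b i - lse I b) * b i) + card I"
proof -
  have "exp (b i - lse I b) * (lse I b - b i) \<le> 1" for i
  proof -
    have "lse I b - b i \<le> exp (lse I b - b i)" using exp_ge_add_one_self[of "lse I b - b i"] by linarith
    then have "exp (b i - lse I b) * (lse I b - b i) \<le> exp (b i - lse I b) * exp (lse I b - b i)"
      by (intro mult_left_mono) auto
    then show ?thesis by (simp flip: exp_add)
  qed
  then have "(\<Sum>i\<in>I. exp (b i - lse I b) * (lse I b - b i)) \<le> (\<Sum>i\<in>I. 1)" by (intro sum_mono)
  moreover have "(\<Sum>i\<in>I. exp (b i - lse I b) * (lse I b - b i))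
      = (\<Sum>i\<in>I. exp (b i - lse I b)) * lse I b - (\<Sum>i\<in>I. exp (b i - lse I b) * b i)"
    by (simp add: right_diff_distrib sum_subtractf sum_distrib_right)
  ultimately show ?thesis by (simp add: sum_softmax)
qed

text \<open>The Kantorovich dual with the maximum over \<open>I\<close> replaced by its smooth version \<open>lse I\<close>. It is
  invariant under adding constants to \<open>\<phi>\<close> and otherwise coercive, so it has a maximizer; there the
  softmax weights have the prescribed masses.\<close>

lemma smoothed_dual_maximizer:
  fixes m :: "'a measure" and c :: "'i \<Rightarrow> 'a \<Rightarrow> real"
  assumes m: "prob_space m" and c: "\<And>i. i \<in> I \<Longrightarrow> integrable m (c i)"
    and w: "\<And>i. i \<in> I \<Longrightarrow> 0 < w i" "sum w I = 1"
  obtains \<phi> where "\<And>\<phi>'. (\<Sum>i\<in>I. w i * \<phi>' i) - (\<integral>t. lse I (\<lambda>i. \<phi>' i - c i t) \<partial>m)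
      \<le> (\<Sum>i\<in>I. w i * \<phi> i) - (\<integral>t. lse I (\<lambda>i. \<phi> i - c i t) \<partial>m)"
    and "\<And>\<phi>'. integrable m (\<lambda>t. lse I (\<lambda>i. \<phi>' i - c i t))"
proof -
  interpret prob_space m by fact
  define H where "H \<phi> t = lse I (\<lambda>i. \<phi> i - c i t)" for \<phi> t
  define \<Phi> where "\<Phi> \<phi> = (\<Sum>i\<in>I. w i * \<phi> i) - (\<integral>t. H \<phi> t \<partial>m)" for \<phi>
  have intH: "integrable m (H \<phi>)" for \<phi>
  proof (rule Bochner_Integration.integrable_bound)
    show "integrable m (\<lambda>t. ln (card I) + (\<Sum>i\<in>I. \<bar>\<phi> i - c i t\<bar>))" using c by simp
    show "H \<phi> \<in> borel_measurable m"
      unfolding H_def lse_def using c by (auto intro!: borel_measurable_ln borel_measurable_sum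
          borel_measurable_exp borel_measurable_diff)
    show "AE t in m. norm (H \<phi> t) \<le> norm (ln (card I) + (\<Sum>i\<in>I. \<bar>\<phi> i - c i t\<bar>))"
      unfolding H_def using abs_lse_le by (intro AE_I2) (force intro: order_trans[OF _ abs_ge_self])
  qed
  have shift: "\<Phi> (\<lambda>i. \<phi> i + s) = \<Phi> \<phi>" for \<phi> s
  proof -
    have "H (\<lambda>i. \<phi> i + s) = (\<lambda>t. H \<phi> t + s)"
    proof
      fix t
      show "H (\<lambda>i. \<phi> i + s) t = H \<phi> t + s"
        unfolding H_def using lse_shift[of "\<lambda>i. \<phi> i - c i t" s] by (simp add: algebra_simps)
    qed
    moreover have "(\<Sum>i\<in>I. w i * (\<phi> i + s)) = (\<Sum>i\<in>I. w i * \<phi> i) + s"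
      using w(2) by (simp add: distrib_left sum.distrib flip: sum_distrib_right)
    ultimately show ?thesis unfolding \<Phi>_def using intH by (simp add: prob_space)
  qed
  \<comment> \<open>Only coordinates in \<open>I\<close> occur on the right. The estimate therefore
    gives continuity in the product topology and also shows that \<open>\<Phi>\<close> ignores the
    coordinates outside \<open>I\<close>.\<close>
  have \<Phi>_diff: "\<bar>\<Phi> \<phi> - \<Phi> \<phi>'\<bar> \<le> (\<Sum>i\<in>I. (w i + 1) * \<bar>\<phi> i - \<phi>' i\<bar>)" for \<phi> \<phi>'
  proof -
    have le: "H \<phi> t \<le> H \<phi>' t + (\<Sum>i\<in>I. \<bar>\<phi> i - \<phi>' i\<bar>)" for \<phi> \<phi>' t
      unfolding H_def using lse_diff_le[of "\<lambda>i. \<phi> i - c i t" "\<lambda>i. \<phi>' i - c i t"] by simp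
    have "(\<integral>t. H \<phi> t \<partial>m) \<le> (\<integral>t. H \<phi>' t + (\<Sum>i\<in>I. \<bar>\<phi> i - \<phi>' i\<bar>) \<partial>m)" for \<phi> \<phi>'
      by (intro integral_mono) (use intH le in auto)
    then have "(\<integral>t. H \<phi> t \<partial>m) \<le> (\<integral>t. H \<phi>' t \<partial>m) + (\<Sum>i\<in>I. \<bar>\<phi> i - \<phi>' i\<bar>)" for \<phi> \<phi>'
      using intH by (simp add: prob_space)
    from this[of \<phi> \<phi>'] this[of \<phi>' \<phi>]
    have "\<bar>(\<integral>t. H \<phi> t \<partial>m) - (\<integral>t. H \<phi>' t \<partial>m)\<bar> \<le> (\<Sum>i\<in>I. \<bar>\<phi> i - \<phi>' i\<bar>)"
      by (simp add: abs_minus_commute)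
    moreover have "\<bar>(\<Sum>i\<in>I. w i * \<phi> i) - (\<Sum>i\<in>I. w i * \<phi>' i)\<bar> \<le> (\<Sum>i\<in>I. w i * \<bar>\<phi> i - \<phi>' i\<bar>)"
    proof -
      have "\<bar>\<Sum>i\<in>I. w i * (\<phi> i - \<phi>' i)\<bar> \<le> (\<Sum>i\<in>I. \<bar>w i * (\<phi> i - \<phi>' i)\<bar>)" by (rule sum_abs)
      also have "\<dots> = (\<Sum>i\<in>I. w i * \<bar>\<phi> i - \<phi>' i\<bar>)"
        using w(1) by (intro sum.cong) (auto simp: abs_mult less_imp_le)
      finally show ?thesis by (simp add: right_diff_distrib sum_subtractf)
    qed
    ultimately show ?thesis unfolding \<Phi>_def by (simp add: distrib_right sum.distrib)
  qed
  have cont: "continuous_on UNIV \<Phi>"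
    unfolding continuous_on_def
  proof
    fix \<phi> :: "'i \<Rightarrow> real"
    have "continuous_on UNIV (\<lambda>\<phi>' :: 'i \<Rightarrow> real. \<phi>' i)" for i
      by (rule continuous_on_product_coordinates)
    then have "((\<lambda>\<phi>'. \<phi>' i) \<longlongrightarrow> \<phi> i) (at \<phi>)" for i
      by (simp add: continuous_on_def)
    then have "((\<lambda>\<phi>'. \<Sum>i\<in>I. (w i + 1) * \<bar>\<phi>' i - \<phi> i\<bar>) \<longlongrightarrow> (\<Sum>i\<in>I. (w i + 1) * \<bar>\<phi> i - \<phi> i\<bar>)) (at \<phi>)"
      by (intro tendsto_intros)
    then have "((\<lambda>\<phi>'. \<Sum>i\<in>I. (w i + 1) * \<bar>\<phi>' i - \<phi> i\<bar>) \<longlongrightarrow> 0) (at \<phi>)" by simp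
    then have "((\<lambda>\<phi>'. \<Phi> \<phi>' - \<Phi> \<phi>) \<longlongrightarrow> 0) (at \<phi>)"
      by (rule Lim_null_comparison[rotated, of "\<lambda>\<phi>'. \<Sum>i\<in>I. (w i + 1) * \<bar>\<phi>' i - \<phi> i\<bar>"])
        (simp_all add: \<Phi>_diff)
    then show "(\<Phi> \<longlongrightarrow> \<Phi> \<phi>) (at \<phi>)" using LIM_zero_cancel by blast
  qed
  define w0 where "w0 = Min (w ` I)"
  have w0: "0 < w0" "\<And>i. i \<in> I \<Longrightarrow> w0 \<le> w i" using I w(1) by (auto simp: w0_def)
  \<comment> \<open>For \<open>\<psi>\<close> with maximum 0 on \<open>I\<close>, a coordinate below
    \<open>- R\<close> forces \<open>\<Phi> \<psi>\<close> below \<open>C0 - w0 * R\<close>. The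
    choice of \<open>R\<close> makes this at most \<open>\<Phi> (\<lambda>_. 0)\<close>, so the
    search can be confined to a box.\<close>
  define C0 where "C0 = (\<Sum>i\<in>I. (\<integral>t. \<bar>c i t\<bar> \<partial>m))"
  define R where "R = max 0 ((C0 - \<Phi> (\<lambda>_. 0)) / w0)"
  \<comment> \<open>The box ranges over the whole index type because the topology on functions is
    the product over all coordinates; Tychonoff then gives compactness. Membership is arranged below
    by setting coordinates outside \<open>I\<close> to 0.\<close>
  define Q :: "('i \<Rightarrow> real) set" where "Q = (\<Pi>\<^sub>E i\<in>UNIV. {-R..0})"
  have "compact Q"
    unfolding Q_def using compactin_PiE[of "\<lambda>_::'i. euclidean :: real topology" UNIV "\<lambda>_. {-R..0}"]
    by (simp add: euclidean_product_topology)
  moreover have zeroQ: "(\<lambda>_. 0) \<in> Q" by (auto simp: Q_def R_def PiE_UNIV_domain)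
  ultimately obtain \<phi> where \<phi>: "\<phi> \<in> Q" "\<And>\<phi>'. \<phi>' \<in> Q \<Longrightarrow> \<Phi> \<phi>' \<le> \<Phi> \<phi>"
    using continuous_attains_sup[of Q \<Phi>] continuous_on_subset[OF cont] by auto
  have "\<Phi> \<phi>' \<le> \<Phi> \<phi>" for \<phi>'
  proof -
    \<comment> \<open>Normalization by \<open>shift\<close>: subtracting the maximum makes all
      coordinates on \<open>I\<close> nonpositive and the coordinate \<open>j\<close> equal to 0,
      which bounds the smooth maximum from below by \<open>- \<bar>c j t\<bar>\<close>.\<close>
    define a where "a = Max (\<phi>' ` I)"
    have "a \<in> \<phi>' ` I" unfolding a_def using I by (intro Max_in) auto
    then obtain j where j: "j \<in> I" "\<phi>' j = a" by auto
    define \<psi> where "\<psi> i = \<phi>' i + (- a)" for i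
    have \<psi>: "\<psi> i \<le> 0" if "i \<in> I" for i
    proof -
      have "\<phi>' i \<le> a" unfolding a_def using I that by (intro Max_ge) auto
      then show ?thesis by (simp add: \<psi>_def)
    qed
    have \<Phi>\<psi>: "\<Phi> \<psi> = \<Phi> \<phi>'" unfolding \<psi>_def by (rule shift)
    show ?thesis
    proof (cases "\<forall>i\<in>I. - R \<le> \<psi> i")
      case True
      define \<psi>' where "\<psi>' i = (if i \<in> I then \<psi> i else 0)" for i
      have "\<psi>' \<in> Q" using True \<psi> by (auto simp: Q_def \<psi>'_def R_def PiE_UNIV_domain)
      moreover have "\<Phi> \<psi>' = \<Phi> \<psi>" using \<Phi>_diff[of \<psi>' \<psi>] by (simp add: \<psi>'_def)
      ultimately show ?thesis using \<phi>(2)[of \<psi>'] \<Phi>\<psi> by simp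
    next
      case False
      then obtain k where k: "k \<in> I" "\<psi> k < - R" by auto
      have "- C0 \<le> (\<integral>t. H \<psi> t \<partial>m)"
      proof -
        have "(\<integral>t. \<bar>c j t\<bar> \<partial>m) \<le> C0"
          unfolding C0_def using I j by (intro member_le_sum[of j I "\<lambda>i. (\<integral>t. \<bar>c i t\<bar> \<partial>m)"]) auto
        then have "- C0 \<le> (\<integral>t. - \<bar>c j t\<bar> \<partial>m)" by simp
        also have "\<dots> \<le> (\<integral>t. H \<psi> t \<partial>m)"
        proof (rule integral_mono)
          show "integrable m (\<lambda>t. - \<bar>c j t\<bar>)" using c j by simp
          show "- \<bar>c j t\<bar> \<le> H \<psi> t" for t
            using lse_ge[OF j(1), of "\<lambda>i. \<psi> i - c i t"] j(2) by (simp add: H_def \<psi>_def)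
        qed (rule intH)
        finally show ?thesis .
      qed
      moreover have "(\<Sum>i\<in>I. w i * \<psi> i) \<le> w k * \<psi> k"
      proof -
        have "(\<Sum>i\<in>I - {k}. w i * \<psi> i) \<le> 0"
          using \<psi> w(1) by (intro sum_nonpos) (auto simp: mult_le_0_iff less_imp_le)
        then show ?thesis using I k by (simp add: sum.remove[of I k])
      qed
      moreover have "w k * \<psi> k \<le> w0 * \<psi> k"
        using w0(2)[OF k(1)] \<psi>[OF k(1)] by (rule mult_right_mono_neg)
      moreover have "w0 * \<psi> k \<le> w0 * - ((C0 - \<Phi> (\<lambda>_. 0)) / w0)"
        using k(2) w0(1) by (intro mult_left_mono) (auto simp: R_def)
      ultimately have "\<Phi> \<psi> \<le> \<Phi> (\<lambda>_. 0)" using w0(1) by (simp add: \<Phi>_def)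
      then show ?thesis using \<phi>(2)[OF zeroQ] \<Phi>\<psi> by simp
    qed
  qed
  then show ?thesis using that intH unfolding \<Phi>_def H_def by blast
qed

text \<open>The softmax weights at the dual maximizer act as the conditional probability of index
  \<open>i\<close> given the point \<open>t\<close>. Optimality in each coordinate fixes their
  masses, and the entropy bound compares their cost with the dual value.\<close>

lemma softmax_plan:
  fixes m :: "'a measure" and c :: "'i \<Rightarrow> 'a \<Rightarrow> real"
  assumes m: "prob_space m" and c: "\<And>i. i \<in> I \<Longrightarrow> integrable m (c i)"
    and w: "\<And>i. i \<in> I \<Longrightarrow> 0 < w i" "sum w I = 1"
  obtains \<phi> p where "\<And>i. i \<in> I \<Longrightarrow> p i \<in> borel_measurable m" "\<And>i t. 0 \<le> p i t"
    "\<And>t. (\<Sum>i\<in>I. p i t) = 1" "\<And>i. i \<in> I \<Longrightarrow> (\<integral>t. p i t \<partial>m) = w i"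
    "(\<Sum>i\<in>I. \<integral>t. p i t * c i t \<partial>m)
      \<le> (\<Sum>i\<in>I. w i * \<phi> i) - (\<integral>t. lse I (\<lambda>i. \<phi> i - c i t) \<partial>m) + card I"
proof -
  interpret prob_space m by fact
  obtain \<phi> where max: "\<And>\<phi>'. (\<Sum>i\<in>I. w i * \<phi>' i) - (\<integral>t. lse I (\<lambda>i. \<phi>' i - c i t) \<partial>m)
      \<le> (\<Sum>i\<in>I. w i * \<phi> i) - (\<integral>t. lse I (\<lambda>i. \<phi> i - c i t) \<partial>m)"
    and int: "\<And>\<phi>'. integrable m (\<lambda>t. lse I (\<lambda>i. \<phi>' i - c i t))"
    using smoothed_dual_maximizer[of m c w] m c w by blast
  \<comment> \<open>The value 0 outside \<open>I\<close> makes \<open>0 \<le> p i t \<le> 1\<close>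
    hold for every index.\<close>
  define p where "p i t = (if i \<in> I then exp ((\<phi> i - c i t) - lse I (\<lambda>i. \<phi> i - c i t)) else 0)" for i t
  have p_meas: "p i \<in> borel_measurable m" if "i \<in> I" for i
    using c[OF that] int[of \<phi>] that unfolding p_def by simp
  have p_nonneg: "0 \<le> p i t" for i t by (simp add: p_def)
  have p_sum: "(\<Sum>i\<in>I. p i t) = 1" for t
    using sum_softmax[of "\<lambda>i. \<phi> i - c i t"] by (simp add: p_def)
  have p_le: "p i t \<le> 1" for i t
    using member_le_sum[of i I "\<lambda>i. p i t"] I p_sum[of t] p_nonneg by (cases "i \<in> I") (auto simp: p_def)
  have p_int: "integrable m (p i)" if "i \<in> I" for i
    using p_meas[OF that] p_nonneg p_le
    by (intro integrable_const_bound[where B = 1]) auto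
  have pc_int: "integrable m (\<lambda>t. p i t * c i t)" if i: "i \<in> I" for i
  proof (rule Bochner_Integration.integrable_bound[OF c[OF i]])
    show "(\<lambda>t. p i t * c i t) \<in> borel_measurable m" using p_meas[OF i] c[OF i] by simp
    show "AE t in m. norm (p i t * c i t) \<le> norm (c i t)"
      using p_nonneg p_le by (intro AE_I2) (auto simp: abs_mult intro!: mult_left_le_one_le)
  qed
  have p_mass: "(\<integral>t. p j t \<partial>m) = w j" if j: "j \<in> I" for j
  proof -
    \<comment> \<open>Maximality of \<open>\<phi>\<close> is tested against moving only coordinate
      \<open>j\<close> by \<open>s\<close>. The right-hand side vanishes at \<open>s = 0\<close>,
      which is therefore a minimum; its derivative there is the difference of the masses.\<close>
    have ge: "0 \<le> (exp s - 1) * (\<integral>t. p j t \<partial>m) - w j * s" for s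
    proof -
      have "(\<integral>t. lse I (\<lambda>i. (\<phi>(j := \<phi> j + s)) i - c i t) \<partial>m)
          \<le> (\<integral>t. lse I (\<lambda>i. \<phi> i - c i t) + (exp s - 1) * p j t \<partial>m)"
      proof (rule integral_mono)
        fix t
        have "(\<lambda>i. (\<phi>(j := \<phi> j + s)) i - c i t) = (\<lambda>i. \<phi> i - c i t)(j := (\<phi> j - c j t) + s)"
          by auto
        then show "lse I (\<lambda>i. (\<phi>(j := \<phi> j + s)) i - c i t)
            \<le> lse I (\<lambda>i. \<phi> i - c i t) + (exp s - 1) * p j t"
          using lse_update_le[OF j, of "\<lambda>i. \<phi> i - c i t" s] j by (simp add: p_def)
      qed (use int p_int[OF j] in auto)
      also have "\<dots> = (\<integral>t. lse I (\<lambda>i. \<phi> i - c i t) \<partial>m) + (exp s - 1) * (\<integral>t. p j t \<partial>m)"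
        using int p_int[OF j] by simp
      finally have 1: "(\<integral>t. lse I (\<lambda>i. (\<phi>(j := \<phi> j + s)) i - c i t) \<partial>m)
          \<le> (\<integral>t. lse I (\<lambda>i. \<phi> i - c i t) \<partial>m) + (exp s - 1) * (\<integral>t. p j t \<partial>m)" .
      have "(\<Sum>i\<in>I. w i * (\<phi>(j := \<phi> j + s)) i) = (\<Sum>i\<in>I. w i * \<phi> i) + w j * s"
        using I j by (simp add: sum.remove[of I j] distrib_left)
      then show ?thesis using max[of "\<phi>(j := \<phi> j + s)"] 1 by linarith
    qed
    have "((\<lambda>s. (exp s - 1) * (\<integral>t. p j t \<partial>m) - w j * s) has_real_derivative
        (\<integral>t. p j t \<partial>m) - w j) (at 0)"
      by (auto intro!: derivative_eq_intros)
    then have "(\<integral>t. p j t \<partial>m) - w j = 0"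
      by (rule DERIV_local_min[where d = 1]) (use ge in auto)
    then show ?thesis by simp
  qed
  have "(\<Sum>i\<in>I. \<integral>t. p i t * c i t \<partial>m) = (\<integral>t. (\<Sum>i\<in>I. p i t * c i t) \<partial>m)"
    using pc_int by simp
  also have "\<dots> \<le> (\<integral>t. (\<Sum>i\<in>I. p i t * \<phi> i) - lse I (\<lambda>i. \<phi> i - c i t) + card I \<partial>m)"
  proof (rule integral_mono)
    fix t
    show "(\<Sum>i\<in>I. p i t * c i t) \<le> (\<Sum>i\<in>I. p i t * \<phi> i) - lse I (\<lambda>i. \<phi> i - c i t) + card I"
      using lse_le_softmax_average[of "\<lambda>i. \<phi> i - c i t"]
      by (simp add: p_def right_diff_distrib sum_subtractf)
  qed (use int p_int pc_int in auto)
  also have "\<dots> = (\<Sum>i\<in>I. w i * \<phi> i) - (\<integral>t. lse I (\<lambda>i. \<phi> i - c i t) \<partial>m) + card I"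
    using int p_int p_mass by (simp add: prob_space)
  finally show ?thesis using that p_meas p_nonneg p_sum p_mass by blast
qed

end

\<comment> \<open>keeps the simplifier from turning \<open>{1..N}\<close> into \<open>{Suc 0..N}\<close>\<close>
declare One_nat_def [simp del]

text \<open>The weights are the density of a joint law of index and point with respect to counting
  measure times \<open>m\<close>. Pushing the index \<open>i\<close> to \<open>x i\<close> gives the
  coupling; working with indices first allows several \<open>x i\<close> to coincide.\<close>

lemma semidiscrete_coupling:
  fixes X :: "'a::{metric_space, second_countable_topology} set"
  assumes m: "m \<in> prob1_on X" and N: "1 \<le> N" and x: "x ` {1..N} \<subseteq> X"
    and p_meas: "\<And>i. i \<in> {1..N} \<Longrightarrow> p i \<in> borel_measurable m"
    and p_nonneg: "\<And>i t. 0 \<le> p i t"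
    and p_sum: "\<And>t. (\<Sum>i=1..N. p i t) = 1"
    and p_mass: "\<And>i. i \<in> {1..N} \<Longrightarrow> (\<integral>t. p i t \<partial>m) = 1 / real N"
  obtains \<rho> where "\<rho> \<in> couplings X (empirical X N x) m"
    and "(\<integral>(s, t). dist s t \<partial>\<rho>) = (\<Sum>i=1..N. \<integral>t. p i t * dist (x i) t \<partial>m)"
proof -
  have m': "m \<in> prob_on X" and "prob_space m" using m by (auto simp: prob1_on_def prob_on_def)
  interpret prob_space m by fact
  have sets_m: "sets m = sets (borel_of_set X)" using m' by (simp add: prob_on_def)
  have space_m: "space m = X" by (rule space_prob_on[OF m'])
  let ?C = "count_space {1..N} \<Otimes>\<^sub>M m"
  define Q where "Q = density ?C (\<lambda>(i, t). ennreal (p i t))"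
  define \<rho> where "\<rho> = distr Q (borel_of_set (X \<times> X)) (\<lambda>(i, t). (x i, t))"
  have p_meas': "(\<lambda>(i, t). ennreal (p i t)) \<in> borel_measurable ?C"
    using p_meas by (intro measurable_pair_measure_countable1) auto
  have sets_Q: "sets Q = sets ?C" by (simp add: Q_def)
  have meas_Q: "f \<in> Q \<rightarrow>\<^sub>M K" if "\<And>i. i \<in> {1..N} \<Longrightarrow> (\<lambda>t. f (i, t)) \<in> m \<rightarrow>\<^sub>M K" for f and K :: "'z measure"
    unfolding measurable_cong_sets[OF sets_Q refl] using that
    by (intro measurable_pair_measure_countable1) auto
  have nn_Q: "(\<integral>\<^sup>+z. v z \<partial>Q) = (\<Sum>i=1..N. \<integral>\<^sup>+t. ennreal (p i t) * v (i, t) \<partial>m)"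
    if v: "v \<in> borel_measurable Q" for v
  proof -
    have v': "v \<in> borel_measurable ?C" using v measurable_cong_sets[OF sets_Q refl] by blast
    have "(\<integral>\<^sup>+z. v z \<partial>Q) = (\<integral>\<^sup>+z. (\<lambda>(i, t). ennreal (p i t)) z * v z \<partial>?C)"
      unfolding Q_def by (rule nn_integral_density[OF p_meas' v'])
    also have "\<dots> = (\<integral>\<^sup>+i. \<integral>\<^sup>+t. (\<lambda>(i, t). ennreal (p i t)) (i, t) * v (i, t) \<partial>m \<partial>count_space {1..N})"
      by (rule nn_integral_fst[symmetric]) (intro borel_measurable_times_ennreal p_meas' v')
    finally show ?thesis by (simp add: nn_integral_count_space_finite)
  qed
  have map_meas: "(\<lambda>(i, t). (x i, t)) \<in> Q \<rightarrow>\<^sub>M borel_of_set (X \<times> X)"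
  proof (rule meas_Q, rule measurable_restrict_space2)
    fix i assume "i \<in> {1..N}"
    then have "x i \<in> X" using x by blast
    then show "(\<lambda>t. case (i, t) of (i, t) \<Rightarrow> (x i, t)) \<in> space m \<rightarrow> X \<times> X"
      by (auto simp: space_m)
    show "(\<lambda>t. case (i, t) of (i, t) \<Rightarrow> (x i, t)) \<in> borel_measurable m"
      by (auto intro!: borel_measurable_prob_on[OF m'] continuous_intros)
  qed
  have fst_meas: "fst \<in> borel_of_set (X \<times> X) \<rightarrow>\<^sub>M borel_of_set X"
    by (intro measurable_restrict_space2 borel_measurable_continuous_on_restrict continuous_intros)
      auto
  have snd_meas: "snd \<in> borel_of_set (X \<times> X) \<rightarrow>\<^sub>M borel_of_set X"
    by (intro measurable_restrict_space2 borel_measurable_continuous_on_restrict continuous_intros)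
      auto
  have nn_\<rho>: "(\<integral>\<^sup>+z. u z \<partial>\<rho>) = (\<Sum>i=1..N. \<integral>\<^sup>+t. ennreal (p i t) * u (x i, t) \<partial>m)"
    if u: "u \<in> borel_measurable (borel_of_set (X \<times> X))" for u
  proof -
    have "(\<integral>\<^sup>+z. u z \<partial>\<rho>) = (\<integral>\<^sup>+z. u ((\<lambda>(i, t). (x i, t)) z) \<partial>Q)"
      unfolding \<rho>_def using u by (intro nn_integral_distr[OF map_meas]) simp
    also have "\<dots> = (\<Sum>i=1..N. \<integral>\<^sup>+t. ennreal (p i t) * u ((\<lambda>(i, t). (x i, t)) (i, t)) \<partial>m)"
      by (rule nn_Q) (rule measurable_compose[OF map_meas u])
    finally show ?thesis by simp
  qed
  have sets_\<rho>: "sets \<rho> = sets (borel_of_set (X \<times> X))" by (simp add: \<rho>_def)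
  have p_nn: "(\<integral>\<^sup>+t. ennreal (p i t) \<partial>m) = ennreal (1 / real N)" if i: "i \<in> {1..N}" for i
  proof -
    \<comment> \<open>A non-integrable function has Bochner integral 0, whereas this integral is
      \<open>1 / real N\<close>, which is nonzero.\<close>
    have "integrable m (p i)"
      using p_mass[OF i] N not_integrable_integral_eq by fastforce
    then show ?thesis using p_nonneg p_mass[OF i] by (simp add: nn_integral_eq_integral)
  qed
  have emp: "empirical X N x \<in> prob_on X" by (rule empirical_in_prob_on[OF x N])
  have marg: "emeasure (distr \<rho> (borel_of_set X) f) A
      = (\<Sum>i=1..N. \<integral>\<^sup>+t. ennreal (p i t) * indicator A (f (x i, t)) \<partial>m)"
    if f: "f \<in> borel_of_set (X \<times> X) \<rightarrow>\<^sub>M borel_of_set X" and A: "A \<in> sets (borel_of_set X)" for f A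
  proof -
    have f': "f \<in> \<rho> \<rightarrow>\<^sub>M borel_of_set X" using f measurable_cong_sets[OF sets_\<rho> refl] by blast
    have "emeasure (distr \<rho> (borel_of_set X) f) A = (\<integral>\<^sup>+z. indicator A z \<partial>distr \<rho> (borel_of_set X) f)"
      using A by simp
    also have "\<dots> = (\<integral>\<^sup>+z. indicator A (f z) \<partial>\<rho>)"
      using A by (intro nn_integral_distr[OF f']) simp
    finally show ?thesis
      using A by (subst (asm) nn_\<rho>) (auto intro!: measurable_compose[OF f] borel_measurable_indicator)
  qed
  have fst_marg: "distr \<rho> (borel_of_set X) fst = empirical X N x"
  proof (rule measure_eqI)
    show "sets (distr \<rho> (borel_of_set X) fst) = sets (empirical X N x)"
      using emp by (simp add: prob_on_def)
    fix A assume "A \<in> sets (distr \<rho> (borel_of_set X) fst)"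
    then have A: "A \<in> sets (borel_of_set X)" by simp
    interpret E: prob_space "empirical X N x" using emp by (simp add: prob_on_def)
    have A': "A \<in> sets (empirical X N x)" using A emp by (simp add: prob_on_def)
    have "measure (empirical X N x) A = (\<integral>z. indicat_real A z \<partial>empirical X N x)"
      using A' sets.sets_into_space[OF A'] by (simp add: Int_absorb2)
    also have "\<dots> = (1 / real N) *\<^sub>R (\<Sum>i=1..N. indicat_real A (x i))"
      using A by (intro integral_empirical[OF x N] borel_measurable_indicator)
    finally have "emeasure (empirical X N x) A = ennreal (\<Sum>i=1..N. 1 / real N * indicat_real A (x i))"
      by (simp add: E.emeasure_eq_measure sum_distrib_left)
    also have "\<dots> = (\<Sum>i=1..N. ennreal (1 / real N * indicat_real A (x i)))"
      by (rule sum_ennreal[symmetric]) simp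
    also have "\<dots> = (\<Sum>i=1..N. ennreal (1 / real N) * indicator A (x i))"
      by (intro sum.cong refl) (simp split: split_indicator)
    also have "\<dots> = emeasure (distr \<rho> (borel_of_set X) fst) A"
      unfolding marg[OF fst_meas A] using p_meas p_nn by (simp add: nn_integral_multc)
    finally show "emeasure (distr \<rho> (borel_of_set X) fst) A = emeasure (empirical X N x) A" by simp
  qed
  have snd_marg: "distr \<rho> (borel_of_set X) snd = m"
  proof (rule measure_eqI)
    show "sets (distr \<rho> (borel_of_set X) snd) = sets m" by (simp add: sets_m)
    fix A assume "A \<in> sets (distr \<rho> (borel_of_set X) snd)"
    then have A: "A \<in> sets (borel_of_set X)" by simp
    then have A': "A \<in> sets m" by (simp add: sets_m)
    have "emeasure (distr \<rho> (borel_of_set X) snd) A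
        = (\<integral>\<^sup>+t. (\<Sum>i=1..N. ennreal (p i t) * indicator A t) \<partial>m)"
      unfolding marg[OF snd_meas A] using p_meas A' by (subst nn_integral_sum) auto
    also have "\<dots> = (\<integral>\<^sup>+t. indicator A t \<partial>m)"
      using p_nonneg p_sum by (simp add: sum_ennreal flip: sum_distrib_right)
    finally show "emeasure (distr \<rho> (borel_of_set X) snd) A = emeasure m A" using A' by simp
  qed
  have "snd \<in> \<rho> \<rightarrow>\<^sub>M borel_of_set X" using snd_meas measurable_cong_sets[OF sets_\<rho> refl] by blast
  then have "prob_space \<rho>" using snd_marg prob_space_distrD \<open>prob_space m\<close> by metis
  then have coupling: "\<rho> \<in> couplings X (empirical X N x) m"
    using fst_marg snd_marg sets_\<rho> by (simp add: couplings_def prob_on_def)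
  have dist_meas: "(\<lambda>(s, t). dist s t) \<in> borel_measurable (borel_of_set (X \<times> X))"
    unfolding case_prod_beta by (intro borel_measurable_continuous_on_restrict continuous_intros)
  have pd_int: "integrable m (\<lambda>t. p i t * dist (x i) t)" if i: "i \<in> {1..N}" for i
  proof (rule Bochner_Integration.integrable_bound)
    show d: "integrable m (\<lambda>t. dist (x i) t)" using x i by (intro integrable_dist[OF m]) auto
    show "(\<lambda>t. p i t * dist (x i) t) \<in> borel_measurable m"
      using p_meas[OF i] d by simp
    have "p i t \<le> 1" for t
      using member_le_sum[of i "{1..N}" "\<lambda>i. p i t"] i p_sum[of t] p_nonneg by auto
    then show "AE t in m. norm (p i t * dist (x i) t) \<le> norm (dist (x i) t)"
      using p_nonneg by (intro AE_I2) (auto simp: abs_mult intro!: mult_left_le_one_le)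
  qed
  have "(\<integral>(s, t). dist s t \<partial>\<rho>) = enn2real (\<integral>\<^sup>+z. ennreal ((\<lambda>(s, t). dist s t) z) \<partial>\<rho>)"
    using dist_meas measurable_cong_sets[OF sets_\<rho> refl]
    by (intro integral_eq_nn_integral) (blast, auto)
  also have "(\<integral>\<^sup>+z. ennreal ((\<lambda>(s, t). dist s t) z) \<partial>\<rho>)
      = (\<Sum>i=1..N. \<integral>\<^sup>+t. ennreal (p i t) * ennreal (dist (x i) t) \<partial>m)"
    using dist_meas by (subst nn_\<rho>) auto
  also have "\<dots> = (\<Sum>i=1..N. ennreal (\<integral>t. p i t * dist (x i) t \<partial>m))"
    using pd_int p_nonneg
    by (intro sum.cong refl) (simp add: nn_integral_eq_integral flip: ennreal_mult')
  also have "\<dots> = ennreal (\<Sum>i=1..N. \<integral>t. p i t * dist (x i) t \<partial>m)"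
    using p_nonneg by (intro sum_ennreal) auto
  finally have "(\<integral>(s, t). dist s t \<partial>\<rho>) = (\<Sum>i=1..N. \<integral>t. p i t * dist (x i) t \<partial>m)"
    using p_nonneg by (simp add: sum_nonneg)
  then show ?thesis using that coupling by blast
qed

text \<open>The potential \<open>h\<close> is a smooth maximum of functions with Lipschitz constant
  1, hence admissible for \<open>d1\<close>. At \<open>x j\<close> the cost of index
  \<open>j\<close> is 0, so \<open>h\<close> dominates \<open>\<delta> * \<phi> j\<close> there, and
  the scaled dual value is at most the difference of the integrals of \<open>h\<close>.\<close>

lemma semidiscrete_kantorovich_rubinstein:
  fixes X :: "'a::{metric_space, second_countable_topology} set"
  assumes m: "m \<in> prob1_on X" and N: "1 \<le> N" and x: "x ` {1..N} \<subseteq> X" and e: "0 < e"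
  obtains \<rho> where "\<rho> \<in> couplings X (empirical X N x) m"
    and "(\<integral>(s, t). dist s t \<partial>\<rho>) \<le> d1 X (empirical X N x) m + e"
proof -
  have m': "m \<in> prob_on X" and "prob_space m" using m by (auto simp: prob1_on_def prob_on_def)
  have I: "finite {1..N}" "{1..N} \<noteq> {}" using N by auto
  \<comment> \<open>The smoothing scale: the softmax plan has additive error \<open>N\<close> for
    the cost divided by \<open>\<delta>\<close>, which becomes exactly \<open>e\<close> after
    multiplying back.\<close>
  define \<delta> where "\<delta> = e / real N"
  have \<delta>: "0 < \<delta>" "\<delta> * real N = e" using e N by (auto simp: \<delta>_def)
  define c where "c i t = dist (x i) t / \<delta>" for i t
  have int: "integrable m (c i)" if "i \<in> {1..N}" for i
    unfolding c_def using x that by (intro integrable_divide integrable_dist[OF m]) auto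
  have w: "0 < 1 / real N" "(\<Sum>i=1..N. 1 / real N) = 1" using N by auto
  obtain \<phi> p where p: "\<And>i. i \<in> {1..N} \<Longrightarrow> p i \<in> borel_measurable m" "\<And>i t. 0 \<le> p i t"
    "\<And>t. (\<Sum>i=1..N. p i t) = 1" "\<And>i. i \<in> {1..N} \<Longrightarrow> (\<integral>t. p i t \<partial>m) = 1 / real N"
    and cost: "(\<Sum>i=1..N. \<integral>t. p i t * c i t \<partial>m)
      \<le> (\<Sum>i=1..N. 1 / real N * \<phi> i) - (\<integral>t. lse {1..N} (\<lambda>i. \<phi> i - c i t) \<partial>m) + card {1..N}"
  proof (rule softmax_plan[OF I \<open>prob_space m\<close>, of c "\<lambda>_. 1 / real N"])
    show "integrable m (c i)" if "i \<in> {1..N}" for i using that by (rule int)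
    show "(\<Sum>i=1..N. 1 / real N) = 1" by (rule w)
    show "0 < 1 / real N" by (rule w)
  qed (rule that)
  obtain \<rho> where \<rho>: "\<rho> \<in> couplings X (empirical X N x) m"
    "(\<integral>(s, t). dist s t \<partial>\<rho>) = (\<Sum>i=1..N. \<integral>t. p i t * dist (x i) t \<partial>m)"
    using semidiscrete_coupling[OF m N x, of p, OF p] by blast
  define h where "h t = \<delta> * lse {1..N} (\<lambda>i. \<phi> i - c i t)" for t
  have h_le: "h s - h t \<le> dist s t" for s t
  proof -
    have "lse {1..N} (\<lambda>i. \<phi> i - c i s) \<le> lse {1..N} (\<lambda>i. \<phi> i - c i t) + dist s t / \<delta>"
    proof (rule lse_le_shift[OF I])
      fix i
      have "dist (x i) t / \<delta> \<le> (dist (x i) s + dist s t) / \<delta>"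
        using \<delta>(1) by (intro divide_right_mono dist_triangle) simp
      then show "\<phi> i - c i s \<le> \<phi> i - c i t + dist s t / \<delta>"
        by (simp add: c_def add_divide_distrib)
    qed
    from mult_left_mono[OF this, of \<delta>]
    have "h s \<le> \<delta> * (lse {1..N} (\<lambda>i. \<phi> i - c i t) + dist s t / \<delta>)"
      using \<delta>(1) by (simp only: h_def less_imp_le)
    then show ?thesis using \<delta>(1) by (simp add: h_def distrib_left)
  qed
  have lip: "1-lipschitz_on X h"
  proof (rule lipschitz_onI)
    fix s t
    show "dist (h s) (h t) \<le> 1 * dist s t"
      using h_le[of s t] h_le[of t s] by (simp add: dist_real_def abs_le_iff dist_commute)
  qed simp
  have "\<delta> * \<phi> j \<le> h (x j)" if "j \<in> {1..N}" for j
  proof -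
    have "\<phi> j \<le> lse {1..N} (\<lambda>i. \<phi> i - c i (x j))"
      using lse_ge[OF I that, of "\<lambda>i. \<phi> i - c i (x j)"] by (simp only: c_def dist_self)
    then show ?thesis
      unfolding h_def by (rule mult_left_mono) (use \<delta>(1) in \<open>rule less_imp_le\<close>)
  qed
  then have "(\<Sum>j=1..N. \<delta> * \<phi> j) \<le> (\<Sum>j=1..N. h (x j))" by (rule sum_mono)
  then have "(1 / real N) * (\<Sum>j=1..N. \<delta> * \<phi> j) \<le> (1 / real N) * (\<Sum>j=1..N. h (x j))"
    by (rule mult_left_mono) simp
  also have "\<dots> = (\<integral>z. h z \<partial>empirical X N x)"
    using integral_empirical[OF x N borel_measurable_continuous_on_restrict
        [OF lipschitz_on_continuous_on[OF lip]]] by simp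
  finally have mean: "\<delta> * (\<Sum>j=1..N. 1 / real N * \<phi> j) \<le> (\<integral>z. h z \<partial>empirical X N x)"
    by (simp only: sum_distrib_left mult.left_commute)
  have "(\<integral>(s, t). dist s t \<partial>\<rho>) = \<delta> * (\<Sum>i=1..N. \<integral>t. p i t * c i t \<partial>m)"
    unfolding \<rho>(2) c_def using \<delta>(1) by (simp flip: sum_divide_distrib)
  also have "\<dots> \<le> \<delta> * ((\<Sum>i=1..N. 1 / real N * \<phi> i) - (\<integral>t. lse {1..N} (\<lambda>i. \<phi> i - c i t) \<partial>m) + card {1..N})"
    by (rule mult_left_mono[OF cost]) (use \<delta>(1) in \<open>rule less_imp_le\<close>)
  also have "\<dots> = \<delta> * (\<Sum>i=1..N. 1 / real N * \<phi> i) - (\<integral>t. h t \<partial>m) + e"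
  proof -
    have "(\<integral>t. h t \<partial>m) = \<delta> * (\<integral>t. lse {1..N} (\<lambda>i. \<phi> i - c i t) \<partial>m)"
      unfolding h_def by (rule integral_mult_right_zero)
    moreover have "\<delta> * real (card {1..N}) = e" using \<delta>(2) by simp
    ultimately show ?thesis by (simp only: right_diff_distrib distrib_left)
  qed
  also have "\<dots> \<le> (\<integral>z. h z \<partial>empirical X N x) - (\<integral>t. h t \<partial>m) + e" using mean by linarith
  also have "\<dots> \<le> d1 X (empirical X N x) m + e"
    using d1_ge[OF empirical_in_prob1_on[OF x N] m lip] by linarith
  finally show ?thesis using that \<rho>(1) by blast
qed

text \<open>An optimal plan costs no more than any of the nearly optimal couplings just constructed,
  and their excess over \<open>d1\<close> is arbitrarily small.\<close>

lemma optimal_plan_cost_le_d1: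
  fixes X :: "'a::{metric_space, second_countable_topology} set"
  assumes m: "m \<in> prob1_on X" and N: "1 \<le> N" and x: "x ` {1..N} \<subseteq> X"
    and \<rho>: "optimal_plan X (empirical X N x) m \<rho>"
  shows "(\<integral>(s, t). dist s t \<partial>\<rho>) \<le> d1 X (empirical X N x) m"
proof (rule field_le_epsilon)
  fix e :: real assume "0 < e"
  then obtain \<rho>' where "\<rho>' \<in> couplings X (empirical X N x) m"
    "(\<integral>(s, t). dist s t \<partial>\<rho>') \<le> d1 X (empirical X N x) m + e"
    using semidiscrete_kantorovich_rubinstein[OF m N x] by blast
  then show "(\<integral>(s, t). dist s t \<partial>\<rho>) \<le> d1 X (empirical X N x) m + e"
    using \<rho> unfolding optimal_plan_def is_arg_min_linorder by fastforce
qed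

section \<open>Stochastic Frank-Wolfe iterations\<close>

text \<open>One formula serves for first and second moments, with \<open>S\<close> a singleton or a
  pair of draws. If the two draws of a pair coincide, \<open>S\<close> collapses and the result is
  \<open>p\<close> instead of \<open>p\<^sup>2\<close>.\<close>

lemma expectation_bernoulli_all:
  assumes A: "finite A" and S: "S \<subseteq> A" and p: "0 \<le> p" "p \<le> 1"
  shows "measure_pmf.expectation (Pi_pmf A d (\<lambda>_. bernoulli_pmf p)) (\<lambda>P. of_bool (\<forall>a\<in>S. P a)) = p ^ card S"
proof -
  let ?M = "Pi_pmf A d (\<lambda>_. bernoulli_pmf p)"
  let ?B = "\<lambda>a. if a \<in> S then {True} else UNIV"
  have "(\<lambda>P. of_bool (\<forall>a\<in>S. P a)) = indicat_real (Pi A ?B)"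
    using S by (fastforce simp: fun_eq_iff indicator_def Pi_def)
  then have "measure_pmf.expectation ?M (\<lambda>P. of_bool (\<forall>a\<in>S. P a)) = measure_pmf.prob ?M (Pi A ?B)"
    by simp
  also have "\<dots> = (\<Prod>a\<in>A. measure_pmf.prob (bernoulli_pmf p) (?B a))"
    by (rule measure_Pi_pmf_Pi[OF A])
  also have "\<dots> = (\<Prod>a\<in>A. if a \<in> S then p else 1)"
    using p by (intro prod.cong refl) (auto simp: measure_pmf_single)
  also have "\<dots> = p ^ card S"
    using A S by (simp add: prod.If_cases Int_absorb1)
  finally show ?thesis .
qed

text \<open>Squared mean plus variance: in the expanded double sum every entry contributes with
  factor \<open>p\<^sup>2\<close>, and the diagonal entries carry the additional factor
  \<open>p * (1 - p)\<close>.\<close>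

lemma expectation_norm_bernoulli_sum:
  fixes v :: "'i \<Rightarrow> 'h::{real_inner, banach, second_countable_topology}"
  assumes fin: "finite (set_pmf M)" and I: "finite I"
    and B: "\<And>i l. i \<in> I \<Longrightarrow> l \<in> I \<Longrightarrow>
        measure_pmf.expectation M (\<lambda>P. B i P * B l P) = (if i = l then p else p\<^sup>2)"
  shows "measure_pmf.expectation M (\<lambda>P. (norm (\<Sum>i\<in>I. B i P *\<^sub>R v i))\<^sup>2)
    = p\<^sup>2 * (norm (\<Sum>i\<in>I. v i))\<^sup>2 + p * (1 - p) * (\<Sum>i\<in>I. (norm (v i))\<^sup>2)"
proof -
  note int = integrable_measure_pmf_finite[OF fin]
  have "measure_pmf.expectation M (\<lambda>P. (norm (\<Sum>i\<in>I. B i P *\<^sub>R v i))\<^sup>2)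
      = measure_pmf.expectation M (\<lambda>P. \<Sum>l\<in>I. \<Sum>i\<in>I. B i P * B l P * (v i \<bullet> v l))"
    unfolding power2_norm_eq_inner inner_sum_left inner_sum_right
    by (simp add: mult_ac)
  also have "\<dots> = (\<Sum>l\<in>I. \<Sum>i\<in>I. measure_pmf.expectation M (\<lambda>P. B i P * B l P) * (v i \<bullet> v l))"
    by (simp add: Bochner_Integration.integral_sum int del: mult.commute)
  also have "\<dots> = (\<Sum>l\<in>I. \<Sum>i\<in>I. p\<^sup>2 * (v i \<bullet> v l) + (if i = l then p * (1 - p) * (v l \<bullet> v l) else 0))"
    by (intro sum.cong refl) (auto simp: B power2_eq_square algebra_simps)
  also have "\<dots> = (\<Sum>l\<in>I. (\<Sum>i\<in>I. p\<^sup>2 * (v i \<bullet> v l)) + p * (1 - p) * (v l \<bullet> v l))"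
    using I by (simp add: sum.distrib)
  also have "\<dots> = p\<^sup>2 * (norm (\<Sum>i\<in>I. v i))\<^sup>2 + p * (1 - p) * (\<Sum>i\<in>I. (norm (v i))\<^sup>2)"
    unfolding power2_norm_eq_inner inner_sum_left inner_sum_right sum.distrib sum_distrib_left ..
  finally show ?thesis .
qed

lemma power2_norm_sum_le:
  fixes v :: "'i \<Rightarrow> 'h::real_normed_vector"
  assumes "\<And>i. i \<in> I \<Longrightarrow> (norm (v i))\<^sup>2 \<le> D"
  shows "(norm (\<Sum>i\<in>I. v i))\<^sup>2 \<le> (real (card I))\<^sup>2 * D"
proof (cases "I = {}")
  case False
  then obtain i where "i \<in> I" by blast
  from assms[OF this] have D: "0 \<le> D" using zero_le_power2 order_trans by blast
  have "norm (\<Sum>i\<in>I. v i) \<le> (\<Sum>i\<in>I. sqrt D)"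
    using assms by (intro sum_norm_le) (simp add: real_le_rsqrt)
  then have "(norm (\<Sum>i\<in>I. v i))\<^sup>2 \<le> (real (card I) * sqrt D)\<^sup>2"
    by (intro power_mono) auto
  then show ?thesis using D by (simp add: power_mult_distrib)
qed simp

section \<open>Expectations over finitely many histories\<close>

lemma finite_set_pmf_sfw_round: "finite (set_pmf (sfw_round n N k))"
proof -
  have "set_pmf (sfw_round n N k) \<subseteq> PiE_dflt ({1..n k} \<times> {1..N}) False (\<lambda>_. UNIV)"
    unfolding sfw_round_def by (rule order_trans[OF set_Pi_pmf_subset']) (auto simp: PiE_dflt_def)
  then show ?thesis by (rule finite_subset) auto
qed

lemma finite_set_pmf_sfw_draws: "finite (set_pmf (sfw_draws n N k))"
  by (induction k) (auto simp: finite_set_pmf_sfw_round)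

text \<open>The tower property in the form used by the recursion: a bound on the conditional
  expectation given the history is averaged over histories. Finite support lets everything be
  written as a finite sum.\<close>

lemma expectation_sfw_draws_Suc_le:
  fixes \<phi> :: "history \<Rightarrow> real"
  assumes "\<And>h. h \<in> set_pmf (sfw_draws n N k) \<Longrightarrow>
      measure_pmf.expectation (sfw_round n N k) (\<lambda>P. \<phi> (h @ [P])) \<le> \<psi> h"
  shows "measure_pmf.expectation (sfw_draws n N (Suc k)) \<phi>
    \<le> measure_pmf.expectation (sfw_draws n N k) \<psi>"
proof -
  let ?S = "set_pmf (sfw_draws n N k)"
  have fin: "finite ?S" by (rule finite_set_pmf_sfw_draws)
  have "measure_pmf.expectation (sfw_draws n N (Suc k)) \<phi>
      = (\<Sum>h\<in>?S. pmf (sfw_draws n N k) h *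
          measure_pmf.expectation (sfw_round n N k) (\<lambda>P. \<phi> (h @ [P])))"
    using fin by (simp add: pmf_expectation_bind[of ?S] finite_set_pmf_sfw_round)
  also have "\<dots> \<le> (\<Sum>h\<in>?S. pmf (sfw_draws n N k) h * \<psi> h)"
    using assms by (intro sum_mono mult_left_mono) auto
  also have "\<dots> = measure_pmf.expectation (sfw_draws n N k) \<psi>"
    using fin by (subst integral_measure_pmf[of ?S]) auto
  finally show ?thesis .
qed

text \<open>Independence makes the variance term smaller by a factor \<open>N\<close>; only the first of the
  simulated candidates is used.\<close>

lemma expectation_sfw_round_le:
  fixes g :: "'a \<times> 'b \<Rightarrow> 'h::{real_inner, banach, second_countable_topology}"
  assumes diff: "\<And>u. f differentiable (at u)" and lip: "L-lipschitz_on UNIV (gradient f)"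
    and N: "1 \<le> N" and n: "1 \<le> n k"
    and D: "\<And>i. i \<in> {1..N} \<Longrightarrow> (norm (g (x i, yb i) - g (x i, v i)))\<^sup>2 \<le> D"
    and best: "\<And>P. P \<in> set_pmf (sfw_round n N k) \<Longrightarrow>
      is_arg_min (\<lambda>v. f (agg g N x v)) (\<lambda>w. w \<in> {candidate yb v P j | j. j \<in> {1..n k}}) (v' P)"
    and \<omega>: "\<omega> = 2 / (real k + 2)"
  shows "measure_pmf.expectation (sfw_round n N k) (\<lambda>P. f (agg g N x (v' P)))
    \<le> f (agg g N x v) + \<omega> * (gradient f (agg g N x v) \<bullet> (agg g N x yb - agg g N x v))
      + L * D / 2 * (\<omega>\<^sup>2 + \<omega> * (1 - \<omega>) / real N)"
proof -
  let ?M = "sfw_round n N k"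
  define u where "u = agg g N x v"
  define d where "d i = g (x i, yb i) - g (x i, v i)" for i
  define B :: "nat \<Rightarrow> draws \<Rightarrow> real" where "B i P = of_bool (P (1, i))" for i P
  define W where "W P = (\<Sum>i=1..N. B i P *\<^sub>R d i)" for P
  have L: "0 \<le> L" using lip lipschitz_on_nonneg by blast
  have \<omega>01: "0 \<le> \<omega>" "\<omega> \<le> 1" by (auto simp: \<omega>)
  note int = integrable_measure_pmf_finite[OF finite_set_pmf_sfw_round]
  have E1: "measure_pmf.expectation ?M (B i) = \<omega>" if "i \<in> {1..N}" for i
    using expectation_bernoulli_all[of "{1..n k} \<times> {1..N}" "{(1, i)}" \<omega> False] that n \<omega>01
    by (simp add: sfw_round_def B_def[abs_def] \<omega>)
  have E2: "measure_pmf.expectation ?M (\<lambda>P. B i P * B l P) = (if i = l then \<omega> else \<omega>\<^sup>2)"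
    if "i \<in> {1..N}" "l \<in> {1..N}" for i l
  proof -
    have "(\<lambda>P. B i P * B l P) = (\<lambda>P. of_bool (\<forall>a\<in>{(1, i), (1, l)}. P a))"
      by (auto simp: B_def)
    then show ?thesis
      using expectation_bernoulli_all[of "{1..n k} \<times> {1..N}" "{(1, i), (1, l)}" \<omega> False] that n \<omega>01
      by (auto simp: sfw_round_def \<omega> power2_eq_square card_insert_if)
  qed
  have cand: "agg g N x (candidate yb v P 1) = u + (1 / real N) *\<^sub>R W P" for P
  proof -
    have "g (x i, candidate yb v P 1 i) = g (x i, v i) + B i P *\<^sub>R d i" for i
      by (simp add: candidate_def B_def d_def)
    then show ?thesis
      by (simp add: agg_def u_def W_def sum.distrib scaleR_add_right)
  qed
  have mean: "(1 / real N) *\<^sub>R (\<Sum>i=1..N. d i) = agg g N x yb - u"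
    by (simp add: agg_def u_def d_def sum_subtractf scaleR_diff_right)
  have "measure_pmf.expectation ?M (\<lambda>P. f (agg g N x (v' P)))
      \<le> measure_pmf.expectation ?M (\<lambda>P. f u + gradient f u \<bullet> ((1 / real N) *\<^sub>R W P)
          + L / 2 * (norm ((1 / real N) *\<^sub>R W P))\<^sup>2)"
  proof (intro integral_mono_AE int AE_pmfI)
    fix P assume P: "P \<in> set_pmf ?M"
    \<comment> \<open>Since \<open>1 \<le> n k\<close>, the first simulation is among the
      competitors, and the minimizer over all candidates can only be better.\<close>
    have "candidate yb v P 1 \<in> {candidate yb v P j | j. j \<in> {1..n k}}" using n by auto
    then have "f (agg g N x (v' P)) \<le> f (agg g N x (candidate yb v P 1))"
      using best[OF P] unfolding is_arg_min_linorder by blast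
    also have "\<dots> \<le> f u + gradient f u \<bullet> ((1 / real N) *\<^sub>R W P)
          + L / 2 * (norm ((1 / real N) *\<^sub>R W P))\<^sup>2"
      using lipschitz_gradient_upper_bound[OF diff lip, of "u + (1 / real N) *\<^sub>R W P" u]
      unfolding cand by simp
    finally show "f (agg g N x (v' P)) \<le> f u + gradient f u \<bullet> ((1 / real N) *\<^sub>R W P)
          + L / 2 * (norm ((1 / real N) *\<^sub>R W P))\<^sup>2" .
  qed
  also have "\<dots> = f u + gradient f u \<bullet> ((1 / real N) *\<^sub>R measure_pmf.expectation ?M W)
      + L / 2 * ((1 / real N)\<^sup>2 * measure_pmf.expectation ?M (\<lambda>P. (norm (W P))\<^sup>2))"
    by (simp add: int power_mult_distrib power_divide)
  also have "measure_pmf.expectation ?M W = \<omega> *\<^sub>R (\<Sum>i=1..N. d i)"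
    unfolding W_def[abs_def]
    by (simp add: Bochner_Integration.integral_sum int E1 scaleR_sum_right)
  also have "(1 / real N) *\<^sub>R \<omega> *\<^sub>R (\<Sum>i=1..N. d i) = \<omega> *\<^sub>R (agg g N x yb - u)"
    unfolding mean[symmetric] by simp
  also have "measure_pmf.expectation ?M (\<lambda>P. (norm (W P))\<^sup>2)
      = \<omega>\<^sup>2 * (norm (\<Sum>i=1..N. d i))\<^sup>2 + \<omega> * (1 - \<omega>) * (\<Sum>i=1..N. (norm (d i))\<^sup>2)"
    unfolding W_def
    by (rule expectation_norm_bernoulli_sum[OF finite_set_pmf_sfw_round _ E2]) auto
  \<comment> \<open>The squared norm of the sum grows like the square of \<open>N\<close>, the
    variance sum only like \<open>N\<close>. After division by the square of \<open>N\<close> the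
    variance term keeps a factor \<open>1 / N\<close>.\<close>
  also have "f u + gradient f u \<bullet> (\<omega> *\<^sub>R (agg g N x yb - u))
      + L / 2 * ((1 / real N)\<^sup>2 * (\<omega>\<^sup>2 * (norm (\<Sum>i=1..N. d i))\<^sup>2
          + \<omega> * (1 - \<omega>) * (\<Sum>i=1..N. (norm (d i))\<^sup>2)))
      \<le> f u + gradient f u \<bullet> (\<omega> *\<^sub>R (agg g N x yb - u))
      + L / 2 * ((1 / real N)\<^sup>2 * (\<omega>\<^sup>2 * ((real N)\<^sup>2 * D) + \<omega> * (1 - \<omega>) * (real N * D)))"
  proof -
    have "(norm (\<Sum>i=1..N. d i))\<^sup>2 \<le> (real N)\<^sup>2 * D"
      using power2_norm_sum_le[of "{1..N}" d D] D by (simp add: d_def)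
    moreover have "(\<Sum>i=1..N. (norm (d i))\<^sup>2) \<le> real N * D"
      using sum_bounded_above[of "{1..N}" "\<lambda>i. (norm (d i))\<^sup>2" D] D by (simp add: d_def)
    ultimately show ?thesis
      using L \<omega>01 by (intro add_left_mono mult_left_mono add_mono) auto
  qed
  also have "\<dots> = f u + \<omega> * (gradient f u \<bullet> (agg g N x yb - u))
      + L * D / 2 * (\<omega>\<^sup>2 + \<omega> * (1 - \<omega>) / real N)"
    unfolding inner_scaleR_right using N by (simp add: field_simps power2_eq_square)
  finally show ?thesis by (simp add: u_def)
qed

text \<open>Multiplying the step by \<open>(k + 1) * (k + 2)\<close> makes it telescope because
  \<open>(k + 2) * (1 - \<omega>) = k\<close>. The weight vanishes at \<open>k = 0\<close>, so the
  initial value does not enter. The accumulated variance is of order \<open>K * (K - 1) / N\<close>,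
  which \<open>K \<le> 2 * N\<close> keeps linear in \<open>K\<close>.\<close>

lemma frank_wolfe_recursion:
  fixes a :: "nat \<Rightarrow> real"
  assumes N: "1 \<le> N" and K: "1 \<le> K" "K \<le> 2 * N" and c: "0 \<le> c"
    and step: "\<And>k \<omega>. k < K \<Longrightarrow> \<omega> = 2 / (real k + 2) \<Longrightarrow>
      a (Suc k) \<le> (1 - \<omega>) * a k + c / 2 * (\<omega>\<^sup>2 + \<omega> * (1 - \<omega>) / real N)"
  shows "a K \<le> 4 * c / real K"
proof -
  have bound: "real k * (real k + 1) * a k \<le> c / 2 * (4 * real k + real k * (real k - 1) / real N)"
    if "k \<le> K" for k
    using that
  proof (induction k)
    case (Suc k)
    define \<omega> where "\<omega> = 2 / (real k + 2)"
    have \<omega>: "(real k + 2) * \<omega> = 2" "(real k + 2) * (1 - \<omega>) = real k"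
      by (simp_all add: \<omega>_def field_simps)
    have "(real k + 1) * (real k + 2) * a (Suc k)
        \<le> (real k + 1) * (real k + 2) * ((1 - \<omega>) * a k + c / 2 * (\<omega>\<^sup>2 + \<omega> * (1 - \<omega>) / real N))"
      using step[OF _ \<omega>_def] Suc.prems by (intro mult_left_mono) auto
    also have "\<dots> = (real k + 1) * ((real k + 2) * (1 - \<omega>)) * a k
        + c / 2 * ((real k + 1) * \<omega> * ((real k + 2) * \<omega> + (real k + 2) * (1 - \<omega>) / real N))"
      by (simp add: algebra_simps power2_eq_square add_divide_distrib diff_divide_distrib)
    also have "\<dots> = real k * (real k + 1) * a k + c / 2 * ((real k + 1) * \<omega> * (2 + real k / real N))"
      unfolding \<omega> by simp
    \<comment> \<open>Here \<open>(real k + 1) * \<omega> \<le> 2\<close>. The resulting increments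
      add up to the invariant since \<open>k * (k - 1) + 2 * k = (k + 1) * k\<close>.\<close>
    also have "c / 2 * ((real k + 1) * \<omega> * (2 + real k / real N)) \<le> c / 2 * (2 * (2 + real k / real N))"
      using c by (intro mult_left_mono mult_right_mono) (auto simp: \<omega>_def field_simps)
    also have "real k * (real k + 1) * a k + c / 2 * (2 * (2 + real k / real N))
        \<le> c / 2 * (4 * real k + real k * (real k - 1) / real N) + c / 2 * (2 * (2 + real k / real N))"
      using Suc by simp
    also have "\<dots> = c / 2 * (4 * real (Suc k) + real (Suc k) * (real (Suc k) - 1) / real N)"
      using N by (simp add: field_simps)
    finally show ?case by (simp add: algebra_simps)
  qed simp
  have KN: "real K \<le> 2 * real N" using K(2) by linarith
  have "real K * (real K - 1) / real N \<le> real K * 2"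
  proof -
    have "(real K - 1) / real N \<le> 2" using KN N by (simp add: divide_le_eq)
    then have "real K * ((real K - 1) / real N) \<le> real K * 2" by (intro mult_left_mono) auto
    then show ?thesis by simp
  qed
  then have "c / 2 * (4 * real K + real K * (real K - 1) / real N) \<le> c / 2 * (6 * real K)"
    using c by (intro mult_left_mono) auto
  with bound[of K] have "real K * ((real K + 1) * a K) \<le> real K * (3 * c)"
    by (simp add: algebra_simps)
  then have le: "(real K + 1) * a K \<le> 3 * c" using K(1) by simp
  \<comment> \<open>Lowering the factor \<open>real K + 1\<close> to \<open>real K\<close> is valid
    only for positive \<open>a K\<close>; for the other values the claim holds because its
    right-hand side is nonnegative.\<close>
  show ?thesis
  proof (cases "a K \<le> 0")
    case True
    then show ?thesis using c by (meson divide_nonneg_nonneg mult_nonneg_nonneg of_nat_0_le_iff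
          order_trans zero_le_numeral)
  next
    case False
    then have "real K * a K \<le> 4 * c" using le c by (simp add: algebra_simps)
    then show ?thesis using K(1) by (simp add: field_simps)
  qed
qed

lemma sfw_run_feasible:
  assumes run: "sfw_run F g f N x n K yb y" and k: "k \<le> K" and h: "h \<in> set_pmf (sfw_draws n N k)"
    and i: "i \<in> {1..N}"
  shows "y h i \<in> F (x i)"
  using k h
proof (induction k arbitrary: h)
  case 0
  then show ?case using run i by (auto simp: sfw_run_def)
next
  case (Suc k)
  from Suc.prems obtain h' P where h: "h = h' @ [P]" and h': "h' \<in> set_pmf (sfw_draws n N k)"
    and P: "P \<in> set_pmf (sfw_round n N k)" by auto
  have k: "k < K" using Suc.prems by simp
  have "yb h' i \<in> F (x i)" "y h' i \<in> F (x i)"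
    using run k h' i Suc.IH[OF _ h'] by (auto simp: sfw_run_def BR_def is_arg_min_def)
  moreover have "\<exists>j. y h = candidate (yb h') (y h') P j"
    using run k h' P unfolding h sfw_run_def is_arg_min_def by blast
  ultimately show ?case by (auto simp: candidate_def)
qed

text \<open>\<open>T\<close> only has to dominate the minima of the linear models, so it can absorb the error from
  comparing with a competitor that has a different marginal.\<close>

lemma sfw_convergence:
  fixes g :: "'a \<times> 'b \<Rightarrow> 'h::{real_inner, banach, second_countable_topology}"
  assumes diff: "\<And>u. f differentiable (at u)" and lip: "L-lipschitz_on UNIV (gradient f)"
    and N: "1 \<le> N" and K: "1 \<le> K" "K \<le> 2 * N" and n: "\<And>k. k < K \<Longrightarrow> 1 \<le> n k"
    and run: "sfw_run F g f N x n K yb y"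
    and D0: "0 \<le> D"
    and D: "\<And>i v w. i \<in> {1..N} \<Longrightarrow> v \<in> F (x i) \<Longrightarrow> w \<in> F (x i) \<Longrightarrow>
      (norm (g (x i, v) - g (x i, w)))\<^sup>2 \<le> D"
    and T: "\<And>k h. k < K \<Longrightarrow> h \<in> set_pmf (sfw_draws n N k) \<Longrightarrow>
      f (agg g N x (y h)) + gradient f (agg g N x (y h)) \<bullet> (agg g N x (yb h) - agg g N x (y h)) \<le> T"
  shows "measure_pmf.expectation (sfw_draws n N K) (\<lambda>h. f (agg g N x (y h))) \<le> T + 4 * L * D / real K"
proof -
  define a where "a k = measure_pmf.expectation (sfw_draws n N k) (\<lambda>h. f (agg g N x (y h))) - T" for k
  have L: "0 \<le> L" using lip lipschitz_on_nonneg by blast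
  have "a K \<le> 4 * (L * D) / real K"
  proof (rule frank_wolfe_recursion[OF N K])
    show "0 \<le> L * D" using L D0 by simp
    fix k \<omega> assume k: "k < K" and \<omega>: "\<omega> = 2 / (real k + 2)"
    define e where "e = L * D / 2 * (\<omega>\<^sup>2 + \<omega> * (1 - \<omega>) / real N)"
    have \<omega>0: "0 \<le> \<omega>" by (simp add: \<omega>)
    have "measure_pmf.expectation (sfw_draws n N (Suc k)) (\<lambda>h. f (agg g N x (y h)))
        \<le> measure_pmf.expectation (sfw_draws n N k)
            (\<lambda>h. (1 - \<omega>) * f (agg g N x (y h)) + (\<omega> * T + e))"
    proof (rule expectation_sfw_draws_Suc_le)
      fix h assume h: "h \<in> set_pmf (sfw_draws n N k)"
      define u where "u = agg g N x (y h)"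
      have "measure_pmf.expectation (sfw_round n N k) (\<lambda>P. f (agg g N x (y (h @ [P]))))
          \<le> f u + \<omega> * (gradient f u \<bullet> (agg g N x (yb h) - u)) + e"
        unfolding u_def e_def
      proof (rule expectation_sfw_round_le[OF diff lip N _ _ _ \<omega>])
        show "1 \<le> n k" using n k by simp
        fix i assume i: "i \<in> {1..N}"
        have "yb h i \<in> F (x i)" using run k h i by (auto simp: sfw_run_def BR_def is_arg_min_def)
        moreover have "y h i \<in> F (x i)" using sfw_run_feasible[OF run _ h i] k by simp
        ultimately show "(norm (g (x i, yb h i) - g (x i, y h i)))\<^sup>2 \<le> D" by (rule D[OF i])
      next
        fix P assume "P \<in> set_pmf (sfw_round n N k)"
        then show "is_arg_min (\<lambda>v. f (agg g N x v))
            (\<lambda>w. w \<in> {candidate (yb h) (y h) P j | j. j \<in> {1..n k}}) (y (h @ [P]))"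
          using run k h by (simp add: sfw_run_def)
      qed
      \<comment> \<open>The hypothesis on \<open>T\<close> bounds the directional term by
        \<open>T - f u\<close>, which produces the contraction factor
        \<open>1 - \<omega>\<close>.\<close>
      also have "\<dots> \<le> f u + \<omega> * (T - f u) + e"
        using T[OF k h] \<omega>0 by (intro add_right_mono add_left_mono mult_left_mono) (auto simp: u_def)
      finally show "measure_pmf.expectation (sfw_round n N k) (\<lambda>P. f (agg g N x (y (h @ [P]))))
          \<le> (1 - \<omega>) * f (agg g N x (y h)) + (\<omega> * T + e)"
        by (simp add: u_def algebra_simps)
    qed
    also have "\<dots> = (1 - \<omega>) * (a k + T) + (\<omega> * T + e)"
      by (simp add: a_def integrable_measure_pmf_finite finite_set_pmf_sfw_draws)
    finally show "a (Suc k) \<le> (1 - \<omega>) * a k + L * D / 2 * (\<omega>\<^sup>2 + \<omega> * (1 - \<omega>) / real N)"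
      by (simp add: a_def e_def algebra_simps)
  qed
  then show ?thesis by (simp add: a_def)
qed

section \<open>Best responses and bridging\<close>

lemma integrable_bounded_prob_on:
  fixes g :: "'a::topological_space \<Rightarrow> 'h::{banach, second_countable_topology}"
  assumes \<mu>: "\<mu> \<in> prob_on Z" and g: "g \<in> borel_measurable (borel_of_set Z)"
    and B: "\<And>z. z \<in> Z \<Longrightarrow> norm (g z) \<le> B"
  shows "integrable \<mu> g" "norm (\<integral>z. g z \<partial>\<mu>) \<le> B"
proof -
  interpret prob_space \<mu> using \<mu> by (simp add: prob_on_def)
  have meas: "g \<in> borel_measurable \<mu>"
    using g by (simp only: measurable_prob_on[OF \<mu>])
  have le: "norm (g z) \<le> B" if "z \<in> space \<mu>" for z using B that by (simp add: space_prob_on[OF \<mu>])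
  show int: "integrable \<mu> g" using meas le by (intro integrable_const_bound[where B = B]) auto
  have "norm (\<integral>z. g z \<partial>\<mu>) \<le> (\<integral>z. norm (g z) \<partial>\<mu>)" by (rule integral_norm_bound)
  also have "\<dots> \<le> (\<integral>z. B \<partial>\<mu>)" using int le by (intro integral_mono) auto
  finally show "norm (\<integral>z. g z \<partial>\<mu>) \<le> B" by (simp add: prob_space)
qed

text \<open>The optimal value of the linearized problem at \<open>t\<close> is Lipschitz in \<open>t\<close>, hence an admissible
  test function for \<open>d1\<close> up to scaling; no transport plan is needed in this direction.\<close>

lemma best_response_gap:
  fixes X :: "'a::{metric_space, second_countable_topology} set"
    and F :: "'a \<Rightarrow> 'b::{second_countable_topology} set"
    and g :: "'a \<times> 'b \<Rightarrow> 'h::{real_inner, banach, second_countable_topology}"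
  assumes m: "m \<in> prob1_on X" and N: "1 \<le> N" and x: "x ` {1..N} \<subseteq> X"
    and \<mu>: "\<mu> \<in> prob_with_marginal X (Sigma X F) m"
    and g: "g \<in> borel_measurable (borel_of_set (Sigma X F))"
    and B: "\<And>z. z \<in> Sigma X F \<Longrightarrow> norm (g z) \<le> B"
    and lip: "lipschitz_setmap_on Lg X (\<lambda>x. {g (x, y) | y. y \<in> F x})" and Lg: "0 \<le> Lg"
    and BR: "\<And>t. t \<in> X \<Longrightarrow> BR F g l t \<noteq> {}"
    and yb: "\<And>i. i \<in> {1..N} \<Longrightarrow> yb i \<in> BR F g l (x i)"
  shows "l \<bullet> agg g N x yb - l \<bullet> (\<integral>z. g z \<partial>\<mu>) \<le> norm l * Lg * d1 X (empirical X N x) m"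
proof -
  have "\<forall>t\<in>X. \<exists>v. v \<in> BR F g l t" using BR by blast
  then obtain b where b: "\<And>t. t \<in> X \<Longrightarrow> b t \<in> BR F g l t" by metis
  define h where "h t = l \<bullet> g (t, b t)" for t
  have bF: "b t \<in> F t" if "t \<in> X" for t using b[OF that] by (simp add: BR_def is_arg_min_def)
  have h_le: "h t \<le> l \<bullet> g (t, v)" if "t \<in> X" "v \<in> F t" for t v
    using b[OF that(1)] that(2) by (simp add: BR_def is_arg_min_linorder scal_def h_def)
  \<comment> \<open>The optimal value at \<open>t\<close> is nearly matched at \<open>s\<close> by
    the point that the Lipschitz property of the value sets provides. Measurability of
    \<open>h\<close> rests on this estimate, not on the arbitrary selection
    \<open>b\<close>.\<close>
  have h_diff: "h s - h t \<le> norm l * Lg * dist s t" if s: "s \<in> X" and t: "t \<in> X" for s t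
  proof -
    have "g (t, b t) \<in> {g (s, y) | y. y \<in> F s} + cball 0 (Lg * dist t s)"
      using lip s t bF[OF t] unfolding lipschitz_setmap_on_def by blast
    then obtain v w where v: "v \<in> F s" and w: "norm w \<le> Lg * dist t s" and e: "g (t, b t) = g (s, v) + w"
      by (auto elim!: set_plus_elim)
    have "h s \<le> h t - l \<bullet> w" using h_le[OF s v] by (simp add: h_def[of t] e inner_add_right)
    moreover have "- (l \<bullet> w) \<le> norm l * norm w" using norm_cauchy_schwarz[of l "- w"] by simp
    moreover have "norm l * norm w \<le> norm l * (Lg * dist t s)"
      using w by (rule mult_left_mono) simp
    ultimately show ?thesis by (simp add: dist_commute mult.assoc)
  qed
  have h_lip: "(norm l * Lg)-lipschitz_on X h"
  proof (rule lipschitz_onI)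
    fix s t assume "s \<in> X" "t \<in> X"
    then show "dist (h s) (h t) \<le> norm l * Lg * dist s t"
      using h_diff[of s t] h_diff[of t s] by (simp add: dist_real_def abs_le_iff dist_commute)
  qed (use Lg in simp)
  have h_meas: "h \<in> borel_measurable (borel_of_set X)"
    by (intro borel_measurable_continuous_on_restrict lipschitz_on_continuous_on[OF h_lip])
  have \<mu>': "\<mu> \<in> prob_on (Sigma X F)" and marg: "distr \<mu> (borel_of_set X) fst = m"
    using \<mu> by (auto simp: prob_with_marginal_def)
  have fst_meas: "fst \<in> \<mu> \<rightarrow>\<^sub>M borel_of_set X"
    using space_prob_on[OF \<mu>'] borel_measurable_prob_on[OF \<mu>' continuous_on_fst[OF continuous_on_id]]
    by (intro measurable_restrict_space2) auto
  have int_g: "integrable \<mu> g" by (rule integrable_bounded_prob_on[OF \<mu>' g B])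
  have "integrable (distr \<mu> (borel_of_set X) fst) h" unfolding marg by (rule integrable_lipschitz[OF m h_lip])
  then have int_h: "integrable \<mu> (\<lambda>z. h (fst z))" using integrable_distr_eq[OF fst_meas h_meas] by simp
  have "(\<integral>t. h t \<partial>m) = (\<integral>z. h (fst z) \<partial>\<mu>)"
    unfolding marg[symmetric] by (rule integral_distr[OF fst_meas h_meas])
  also have "\<dots> \<le> (\<integral>z. l \<bullet> g z \<partial>\<mu>)"
  proof (rule integral_mono[OF int_h])
    show "integrable \<mu> (\<lambda>z. l \<bullet> g z)" using int_g by simp
    fix z assume "z \<in> space \<mu>"
    then show "h (fst z) \<le> l \<bullet> g z" using h_le by (auto simp: space_prob_on[OF \<mu>'])
  qed
  also have "\<dots> = l \<bullet> (\<integral>z. g z \<partial>\<mu>)" using int_g by simp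
  finally have 1: "(\<integral>t. h t \<partial>m) \<le> l \<bullet> (\<integral>z. g z \<partial>\<mu>)" .
  \<comment> \<open>\<open>yb i\<close> and \<open>b (x i)\<close> may be different minimizers, but
    they attain the same value.\<close>
  have "h (x i) = l \<bullet> g (x i, yb i)" if i: "i \<in> {1..N}" for i
  proof -
    have xi: "x i \<in> X" using x i by blast
    have "yb i \<in> F (x i)" "l \<bullet> g (x i, yb i) \<le> h (x i)"
      using yb[OF i] bF[OF xi] by (auto simp: BR_def is_arg_min_linorder scal_def h_def)
    then show ?thesis using h_le[OF xi, of "yb i"] by simp
  qed
  then have 2: "(\<integral>t. h t \<partial>empirical X N x) = l \<bullet> agg g N x yb"
    unfolding integral_empirical[OF x N h_meas] by (simp add: agg_def inner_sum_right)
  show ?thesis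
    using d1_ge_scaled[OF empirical_in_prob1_on[OF x N] m h_lip] 1 2 by simp
qed

text \<open>The selection keeps the target point as first component, so the output inherits the
  second marginal of the plan. Pointwise it changes \<open>g\<close> by at most \<open>Lg\<close>
  times the distance moved; integrating gives \<open>Lg\<close> times the optimal cost, which
  \<open>d1\<close> dominates.\<close>

lemma bridging_output_bound:
  fixes X :: "'a::{metric_space, second_countable_topology} set"
    and Z :: "('a \<times> 'b::second_countable_topology) set"
    and g :: "'a \<times> 'b \<Rightarrow> 'h::{banach, second_countable_topology}"
  assumes m: "m \<in> prob1_on X" and N: "1 \<le> N" and x: "x ` {1..N} \<subseteq> X"
    and Z: "Z \<subseteq> X \<times> UNIV"
    and g: "g \<in> borel_measurable (borel_of_set Z)"
    and B: "\<And>z. z \<in> Z \<Longrightarrow> norm (g z) \<le> B"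
    and Lg: "0 \<le> Lg"
    and out: "bridging_output X Z g Lg (empirical X N x) m \<mu>0 \<mu>"
  shows "\<mu> \<in> prob_with_marginal X Z m"
    and "norm ((\<integral>z. g z \<partial>\<mu>) - (\<integral>z. g z \<partial>\<mu>0)) \<le> Lg * d1 X (empirical X N x) m"
proof -
  let ?p = "\<lambda>((x, y), x'). (x, x') :: 'a \<times> 'a"
  obtain \<rho> \<nu> s where plan: "optimal_plan X (empirical X N x) m \<rho>" and \<nu>: "\<nu> \<in> prob_on (Z \<times> X)"
    and \<mu>0: "distr \<nu> (borel_of_set Z) fst = \<mu>0"
    and \<rho>: "distr \<nu> (borel_of_set (X \<times> X)) ?p = \<rho>"
    and s: "s \<in> borel_of_set (Z \<times> X) \<rightarrow>\<^sub>M borel_of_set Z"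
    and s_bridge: "\<And>w. w \<in> Z \<times> X \<Longrightarrow> s w \<in> bridge_set Z g Lg w"
    and \<mu>: "\<mu> = distr \<nu> (borel_of_set Z) s"
    using out unfolding bridging_output_def by blast
  interpret prob_space \<nu> using \<nu> by (simp add: prob_on_def)
  have sp: "space \<nu> = Z \<times> X" by (rule space_prob_on[OF \<nu>])
  have s_meas: "s \<in> \<nu> \<rightarrow>\<^sub>M borel_of_set Z"
    using s by (simp only: measurable_prob_on[OF \<nu>])
  have fst_meas: "fst \<in> \<nu> \<rightarrow>\<^sub>M borel_of_set Z"
    using sp borel_measurable_prob_on[OF \<nu> continuous_on_fst[OF continuous_on_id]]
    by (intro measurable_restrict_space2) auto
  have snd_meas: "snd \<in> \<nu> \<rightarrow>\<^sub>M borel_of_set X"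
  proof (rule measurable_restrict_space2)
    show "snd \<in> space \<nu> \<rightarrow> X" unfolding sp by (simp add: Pi_def mem_Times_iff)
    show "snd \<in> borel_measurable \<nu>"
      by (rule borel_measurable_prob_on[OF \<nu> continuous_on_snd[OF continuous_on_id]])
  qed
  have p_eq: "?p = (\<lambda>w. (fst (fst w), snd w))" by auto
  have p_meas: "?p \<in> \<nu> \<rightarrow>\<^sub>M borel_of_set (X \<times> X)"
    unfolding p_eq using sp Z
    by (intro measurable_restrict_space2 borel_measurable_prob_on[OF \<nu>] continuous_intros) auto
  have proj: "fst \<in> borel_of_set (X \<times> X) \<rightarrow>\<^sub>M borel_of_set X" "snd \<in> borel_of_set (X \<times> X) \<rightarrow>\<^sub>M borel_of_set X"
    by (intro measurable_restrict_space2 borel_measurable_continuous_on_restrict continuous_intros; auto)+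
  have "distr \<rho> (borel_of_set X) fst = empirical X N x" "distr \<rho> (borel_of_set X) snd = m"
    using plan by (auto simp: optimal_plan_def is_arg_min_def couplings_def)
  then have marg1: "distr \<nu> (borel_of_set X) (\<lambda>w. fst (fst w)) = empirical X N x"
    and marg2: "distr \<nu> (borel_of_set X) snd = m"
    unfolding \<rho>[symmetric] distr_distr[OF proj(1) p_meas] distr_distr[OF proj(2) p_meas]
    by (simp_all add: p_eq comp_def)
  have fstfst_meas: "(\<lambda>w. fst (fst w)) \<in> \<nu> \<rightarrow>\<^sub>M borel_of_set X"
    using measurable_compose[OF p_meas proj(1)] by (simp add: p_eq)
  have fst_s: "fst (s w) = snd w" and s_dist: "norm (g (s w) - g (fst w)) \<le> Lg * dist (fst (fst w)) (snd w)"
    if "w \<in> space \<nu>" for w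
    using s_bridge[of w] that sp by (auto simp: bridge_set_def split: prod.splits)
  have \<mu>Z: "\<mu> \<in> prob_on Z" unfolding \<mu> prob_on_def using prob_space_distr[OF s_meas] by simp
  have fst_Z: "fst \<in> borel_of_set Z \<rightarrow>\<^sub>M borel_of_set X"
    using Z by (intro measurable_restrict_space2 borel_measurable_continuous_on_restrict continuous_intros) auto
  have "distr \<mu> (borel_of_set X) fst = distr \<nu> (borel_of_set X) (fst \<circ> s)"
    unfolding \<mu> by (rule distr_distr[OF fst_Z s_meas])
  also have "\<dots> = distr \<nu> (borel_of_set X) snd" using fst_s by (intro distr_cong) auto
  finally show "\<mu> \<in> prob_with_marginal X Z m"
    using \<mu>Z marg2 by (simp add: prob_with_marginal_def)
  obtain x0 where x0: "x0 \<in> X" using m by (auto simp: prob1_on_def)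
  have dist_meas: "(\<lambda>t. dist x0 t) \<in> borel_measurable (borel_of_set X)"
    by (intro borel_measurable_continuous_on_restrict continuous_intros)
  \<comment> \<open>The distance moved is split at \<open>x0\<close>; each part is integrable by the
    first moment of one marginal.\<close>
  have "integrable \<nu> (\<lambda>w. dist x0 (fst (fst w)))"
    using integrable_dist[OF empirical_in_prob1_on[OF x N] x0]
    unfolding marg1[symmetric] integrable_distr_eq[OF fstfst_meas dist_meas] .
  moreover have "integrable \<nu> (\<lambda>w. dist x0 (snd w))"
    using integrable_dist[OF m x0]
    unfolding marg2[symmetric] integrable_distr_eq[OF snd_meas dist_meas] .
  ultimately have "integrable \<nu> (\<lambda>w. dist x0 (fst (fst w)) + dist x0 (snd w))"
    by (rule Bochner_Integration.integrable_add)
  then have int_dist: "integrable \<nu> (\<lambda>w. dist (fst (fst w)) (snd w))"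
    by (rule Bochner_Integration.integrable_bound)
      (auto intro!: borel_measurable_prob_on[OF \<nu>] continuous_intros AE_I2 dist_triangle3)
  have cost: "(\<integral>(s, t). dist s t \<partial>\<rho>) = (\<integral>w. dist (fst (fst w)) (snd w) \<partial>\<nu>)"
    unfolding \<rho>[symmetric]
    by (subst integral_distr[OF p_meas])
      (auto simp: p_eq case_prod_beta intro!: borel_measurable_continuous_on_restrict continuous_intros)
  have int_gs: "integrable \<nu> (\<lambda>w. g (s w))"
    using integrable_bounded_prob_on(1)[OF \<mu>Z g B] unfolding \<mu> integrable_distr_eq[OF s_meas g] .
  have "distr \<nu> (borel_of_set Z) fst \<in> prob_on Z"
    unfolding prob_on_def using prob_space_distr[OF fst_meas] by simp
  then have "integrable (distr \<nu> (borel_of_set Z) fst) g"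
    using g B by (rule integrable_bounded_prob_on(1))
  then have int_gf: "integrable \<nu> (\<lambda>w. g (fst w))"
    unfolding integrable_distr_eq[OF fst_meas g] .
  have "(\<integral>z. g z \<partial>\<mu>) - (\<integral>z. g z \<partial>\<mu>0) = (\<integral>w. g (s w) - g (fst w) \<partial>\<nu>)"
    unfolding \<mu> \<mu>0[symmetric] integral_distr[OF s_meas g] integral_distr[OF fst_meas g]
    using int_gs int_gf by simp
  also have "norm \<dots> \<le> (\<integral>w. norm (g (s w) - g (fst w)) \<partial>\<nu>)" by (rule integral_norm_bound)
  also have "\<dots> \<le> (\<integral>w. Lg * dist (fst (fst w)) (snd w) \<partial>\<nu>)"
    using int_gs int_gf int_dist s_dist by (intro integral_mono) auto
  also have "\<dots> = Lg * (\<integral>(s, t). dist s t \<partial>\<rho>)" by (simp add: cost)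
  also have "\<dots> \<le> Lg * d1 X (empirical X N x) m"
    using optimal_plan_cost_le_d1[OF m N x plan] Lg by (intro mult_left_mono)
  finally show "norm ((\<integral>z. g z \<partial>\<mu>) - (\<integral>z. g z \<partial>\<mu>0)) \<le> Lg * d1 X (empirical X N x) m" .
qed

section \<open>Combining the optimization error with the two transport errors\<close>

theorem theorem6p8:
  fixes X :: "'a::{banach, second_countable_topology} set"
    and F :: "'a \<Rightarrow> 'b::polish_space set"
    and Z :: "('a \<times> 'b) set"
    and g :: "'a \<times> 'b \<Rightarrow> 'h::{real_inner, banach, second_countable_topology}"
    and f :: "'h \<Rightarrow> real"
    and L Lg :: real
    and m :: "'a measure"
    and N K :: nat
    and x :: "nat \<Rightarrow> 'a"
    and n :: "nat \<Rightarrow> nat"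
    and ybar y :: "history \<Rightarrow> nat \<Rightarrow> 'b"
    and \<mu>t :: "history \<Rightarrow> ('a \<times> 'b) measure"
  defines "Z \<equiv> Sigma X F"
  assumes X_closed: "closed X"
    and F_nonempty: "\<And>x. x \<in> X \<Longrightarrow> F x \<noteq> {}"
    and F_closed_graph: "closedin (top_of_set (X \<times> UNIV)) Z"
    and g_measurable: "g \<in> borel_measurable (borel_of_set Z)"
    and f_measurable: "f \<in> borel_measurable borel"
    and g_bounded: "bounded (g ` Z)"
    and f_convex: "convex_on UNIV f"
    and f_differentiable: "\<And>u. f differentiable (at u)"
    and f_gradient_lipschitz: "L-lipschitz_on UNIV (gradient f)"
    and g_lsc: "\<And>l. l \<in> range (gradient f) \<Longrightarrow> lsc_fun_on Z (scal g l)"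
    and G_lsc: "\<And>l. l \<in> range (gradient f) \<Longrightarrow>
                  lsc_setmap_on X (\<lambda>x. {scal g l (x, y) | y. y \<in> F x})"
    and BR_nonempty: "\<And>l x. l \<in> range (gradient f) \<Longrightarrow> x \<in> X \<Longrightarrow> BR F g l x \<noteq> {}"
    and g_continuous: "continuous_on Z g"
    and F_compact: "\<And>x. x \<in> X \<Longrightarrow> compact (F x)"
    and F_usc: "usc_setmap_on X F"
    and Lg_nonneg: "0 \<le> Lg"
    and Z_lipschitz: "lipschitz_setmap_on Lg X (\<lambda>x. {g (x, y) | y. y \<in> F x})"
    and m: "m \<in> prob1_on X"
    and N: "1 \<le> N"
    and x: "\<And>i. i \<in> {1..N} \<Longrightarrow> x i \<in> X"
    and K: "1 \<le> K" "K \<le> 2 * N"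
    and n: "\<And>k. k < K \<Longrightarrow> 1 \<le> n k"
    and sfw: "sfw_run F g f N x n K ybar y"
    and bridging: "\<And>h. h \<in> set_pmf (sfw_draws n N K) \<Longrightarrow>
          bridging_output X Z g Lg (empirical X N x) m (empirical Z N (\<lambda>i. (x i, y h i))) (\<mu>t h)"
  shows "measure_pmf.expectation (sfw_draws n N K) (\<lambda>h. f (\<integral>z. g z \<partial>\<mu>t h))
           - (INF \<mu>\<in>prob_with_marginal X Z m. f (\<integral>z. g z \<partial>\<mu>))
         \<le> 4 * L * const_D Z g / real K
           + 2 * Lg * (const_C Z g f + L * const_M Z g) * d1 X (empirical X N x) m"
proof -
  let ?d = "d1 X (empirical X N x) m"
  let ?C = "const_C Z g f" and ?M = "const_M Z g" and ?D = "const_D Z g"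
  have x': "x ` {1..N} \<subseteq> X" using x by blast
  obtain B where B: "\<And>z. z \<in> Z \<Longrightarrow> norm (g z) \<le> B"
    using g_bounded unfolding bounded_iff by blast
  have L0: "0 \<le> L" using f_gradient_lipschitz lipschitz_on_nonneg by blast
  have x1: "x 1 \<in> X" using x N by simp
  then obtain y1 where z1: "(x 1, y1) \<in> Z" using F_nonempty Z_def by blast
  have d0: "0 \<le> ?d" by (rule d1_nonneg[OF empirical_in_prob1_on[OF x' N] m])
  have "bdd_above ((\<lambda>z. norm (g z)) ` Z)" using B by (intro bdd_aboveI2)
  then have "norm (g (x 1, y1)) \<le> ?M" unfolding const_M_def using z1 by (rule cSUP_upper[rotated])
  then have M0: "0 \<le> ?M" using norm_ge_zero order_trans by blast
  have D: "(norm (g z - g z'))\<^sup>2 \<le> ?D" if "z \<in> Z" "z' \<in> Z" for z z'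
  proof -
    have "norm (g z - g z') \<le> B + B" if "z \<in> Z" "z' \<in> Z" for z z'
      using norm_triangle_ineq4[of "g z" "g z'"] B[OF that(1)] B[OF that(2)] by linarith
    then have "(norm (g z - g z'))\<^sup>2 \<le> (B + B)\<^sup>2" if "z \<in> Z" "z' \<in> Z" for z z'
      using that by (intro power_mono) auto
    then have "bdd_above ((\<lambda>(z, z'). (norm (g z - g z'))\<^sup>2) ` (Z \<times> Z))"
      by (intro bdd_aboveI2[where M = "(B + B)\<^sup>2"]) auto
    then show ?thesis
      unfolding const_D_def using cSUP_upper[of "(z, z')" "Z \<times> Z" "\<lambda>(z, z'). (norm (g z - g z'))\<^sup>2"] that
      by simp
  qed
  have D0: "0 \<le> ?D" using D[OF z1 z1] by simp
  \<comment> \<open>The supremum defining \<open>const_C\<close> has to be bounded before it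
    dominates its members. The Lipschitz gradient is compared with its value at 0, and all means of
    \<open>g\<close> have norm at most \<open>B\<close>.\<close>
  have C: "norm (gradient f (\<integral>z. g z \<partial>\<mu>)) \<le> ?C" if "\<mu> \<in> prob_on Z" for \<mu>
  proof -
    have "norm (gradient f (\<integral>z. g z \<partial>\<mu>)) \<le> norm (gradient f 0) + L * B" if \<mu>: "\<mu> \<in> prob_on Z" for \<mu>
    proof -
      let ?u = "\<integral>z. g z \<partial>\<mu>"
      have "norm (gradient f ?u - gradient f 0) \<le> L * norm ?u"
        using lipschitz_onD[OF f_gradient_lipschitz, of ?u 0] by (simp add: dist_norm)
      also have "\<dots> \<le> L * B"
        using integrable_bounded_prob_on(2)[OF \<mu> g_measurable B] L0 by (rule mult_left_mono)
      finally show ?thesis using norm_triangle_sub[of "gradient f ?u" "gradient f 0"] by linarith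
    qed
    then have "bdd_above ((\<lambda>\<mu>. norm (gradient f (\<integral>z. g z \<partial>\<mu>))) ` prob_on Z)"
      by (rule bdd_aboveI2)
    then show ?thesis unfolding const_C_def using that by (rule cSUP_upper[rotated])
  qed
  let ?H = "set_pmf (sfw_draws n N K)"
  have feas: "(\<lambda>i. (x i, y h i)) ` {1..N} \<subseteq> Z" if "k \<le> K" "h \<in> set_pmf (sfw_draws n N k)" for h k
    using sfw_run_feasible[OF sfw that] x by (auto simp: Z_def)
  have agg_eq: "(\<integral>z. g z \<partial>empirical Z N (\<lambda>i. (x i, y h i))) = agg g N x (y h)"
    if "k \<le> K" "h \<in> set_pmf (sfw_draws n N k)" for h k
    using integral_empirical[OF feas[OF that] N g_measurable] by (simp add: agg_def)
  have ZX: "Z \<subseteq> X \<times> UNIV" by (auto simp: Z_def)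
  note bridge = bridging_output_bound[OF m N x' ZX g_measurable B Lg_nonneg bridging]
  \<comment> \<open>The tangent is taken at the bridged mean, so that convexity bounds the increase
    from above. Its slope is controlled by \<open>?C\<close> because the bridged measure lies in
    \<open>prob_on Z\<close>.\<close>
  have bridge_f: "f (\<integral>z. g z \<partial>\<mu>t h) \<le> f (agg g N x (y h)) + ?C * (Lg * ?d)" if h: "h \<in> ?H" for h
  proof -
    let ?u = "\<integral>z. g z \<partial>\<mu>t h"
    have "f ?u + gradient f ?u \<bullet> (agg g N x (y h) - ?u) \<le> f (agg g N x (y h))"
      by (rule convex_gradient_inequality[OF f_differentiable f_convex])
    moreover have "gradient f ?u \<bullet> (?u - agg g N x (y h)) \<le> ?C * (Lg * ?d)"
    proof -
      have "gradient f ?u \<bullet> (?u - agg g N x (y h)) \<le> norm (gradient f ?u) * norm (?u - agg g N x (y h))"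
        by (rule norm_cauchy_schwarz)
      also have "\<dots> \<le> ?C * (Lg * ?d)"
      proof (rule mult_mono')
        show "norm (gradient f ?u) \<le> ?C" using C bridge(1)[OF _ h] by (simp add: prob_with_marginal_def)
        show "norm (?u - agg g N x (y h)) \<le> Lg * ?d" using bridge(2)[OF _ h] agg_eq[OF _ h] by simp
      qed auto
      finally show ?thesis .
    qed
    ultimately show ?thesis by (simp add: inner_diff_right)
  qed
  \<comment> \<open>Any history of positive probability yields a bridged measure with marginal
    \<open>m\<close>, so the infimum is over a nonempty set.\<close>
  have "?H \<noteq> {}" by (rule set_pmf_not_empty)
  then have nonempty: "prob_with_marginal X Z m \<noteq> {}" using bridge(1) by blast
  let ?E = "measure_pmf.expectation (sfw_draws n N K)"
  let ?R = "4 * L * ?D / real K + 2 * Lg * (?C + L * ?M) * ?d"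
  have "?E (\<lambda>h. f (\<integral>z. g z \<partial>\<mu>t h)) - ?R \<le> f (\<integral>z. g z \<partial>\<mu>)" if \<mu>: "\<mu> \<in> prob_with_marginal X Z m" for \<mu>
  proof -
    let ?v = "\<integral>z. g z \<partial>\<mu>"
    \<comment> \<open>The shifted target \<open>f ?v + ?C * (Lg * ?d)\<close> plays the role of
      \<open>T\<close>. The shift pays for comparing best responses at the sample points with a
      competitor whose marginal is \<open>m\<close>; the bridging step adds the same amount once
      more.\<close>
    have "?E (\<lambda>h. f (agg g N x (y h))) \<le> (f ?v + ?C * (Lg * ?d)) + 4 * L * ?D / real K"
    proof (rule sfw_convergence[OF f_differentiable f_gradient_lipschitz N K n sfw D0])
      show "(norm (g (x i, v) - g (x i, w)))\<^sup>2 \<le> ?D"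
        if "i \<in> {1..N}" "v \<in> F (x i)" "w \<in> F (x i)" for i v w
        using that x by (intro D) (auto simp: Z_def)
      fix k h assume k: "k < K" and h: "h \<in> set_pmf (sfw_draws n N k)"
      let ?u = "agg g N x (y h)"
      let ?l = "gradient f ?u"
      have "norm ?l \<le> ?C"
        using C[OF empirical_in_prob_on[OF feas N]] agg_eq k h by (metis less_imp_le)
      then have "norm ?l * (Lg * ?d) \<le> ?C * (Lg * ?d)"
        using Lg_nonneg d0 by (intro mult_right_mono) auto
      moreover have "?l \<bullet> agg g N x (ybar h) - ?l \<bullet> ?v \<le> norm ?l * Lg * ?d"
      proof (rule best_response_gap[OF m N x' _ _ _ Z_lipschitz Lg_nonneg])
        show "\<mu> \<in> prob_with_marginal X (Sigma X F) m" using \<mu> by (simp add: Z_def)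
        show "g \<in> borel_measurable (borel_of_set (Sigma X F))" using g_measurable by (simp add: Z_def)
        show "norm (g z) \<le> B" if "z \<in> Sigma X F" for z using B that by (simp add: Z_def)
        show "BR F g ?l t \<noteq> {}" if "t \<in> X" for t using BR_nonempty that by blast
        show "ybar h i \<in> BR F g ?l (x i)" if "i \<in> {1..N}" for i
          using sfw k h that by (simp add: sfw_run_def)
      qed
      moreover have "f ?u + ?l \<bullet> (?v - ?u) \<le> f ?v"
        by (rule convex_gradient_inequality[OF f_differentiable f_convex])
      ultimately show "f ?u + ?l \<bullet> (agg g N x (ybar h) - ?u) \<le> f ?v + ?C * (Lg * ?d)"
        by (simp add: inner_diff_right mult.assoc)
    qed
    moreover have "?E (\<lambda>h. f (\<integral>z. g z \<partial>\<mu>t h)) \<le> ?E (\<lambda>h. f (agg g N x (y h)) + ?C * (Lg * ?d))"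
      using bridge_f by (intro integral_mono_AE AE_pmfI integrable_measure_pmf_finite finite_set_pmf_sfw_draws)
    moreover have "?E (\<lambda>h. f (agg g N x (y h)) + ?C * (Lg * ?d)) = ?E (\<lambda>h. f (agg g N x (y h))) + ?C * (Lg * ?d)"
      by (simp add: integrable_measure_pmf_finite finite_set_pmf_sfw_draws)
    \<comment> \<open>With the two errors \<open>?C * (Lg * ?d)\<close> this nonnegative term makes
      up the second summand of \<open>?R\<close>.\<close>
    moreover have "0 \<le> 2 * Lg * (L * ?M) * ?d" using Lg_nonneg L0 M0 d0 by simp
    moreover have "2 * Lg * (?C + L * ?M) * ?d = 2 * (?C * (Lg * ?d)) + 2 * Lg * (L * ?M) * ?d"
      by (simp add: algebra_simps)
    ultimately show ?thesis by linarith
  qed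
  then have "?E (\<lambda>h. f (\<integral>z. g z \<partial>\<mu>t h)) - ?R \<le> (INF \<mu>\<in>prob_with_marginal X Z m. f (\<integral>z. g z \<partial>\<mu>))"
    by (rule cINF_greatest[OF nonempty])
  then show ?thesis by linarith
qed

end
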